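(* Let $0<a_j\le1$ and $0\le\alpha_i<\min_ja_j$. For every $\underline\lambda_N\in\mathbb G_N$ and $t>0$, $$\frac{d}{dt}P_t(\underline\lambda_N)=\sum_{\underline\mu_N\in\mathbb G_N}P_t(\underline\mu_N)L(\underline\mu_N,\underline\lambda_N),\qquad L(\underline\mu_N,\underline\lambda_N)=\sum_{1\le j\le k\le N}r_{jk}(\underline\mu_N)\big(\delta_{\underline\lambda_N,\underline\mu_N^{jk+}}-\delta_{\underline\lambda_N,\underline\mu_N}\big),$$ with $$r_{jk}(\underline\mu_N)=a_k\frac{(1-q^{\mu^{(k-1)}_{j-1}-\mu^{(k)}_j})(1-q^{\mu^{(k)}_j-\mu^{(k)}_{j+1}+1})}{1-q^{\mu^{(k)}_j-\mu^{(k-1)}_j+1}},$$ using the conventions $\mu^{(i)}_0=+\infty$ and $\mu^{(i)}_{i+1}=-\infty$. Moreover $L$ is the generator of a continuous-time Markov chain on $\mathbb G_N$ (off-diagonal entries nonnegative, rows summing to zero).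
   Context: Fix $0<q<1$; $(x;q)_\infty=\prod_{k\ge0}(1-xq^k)$, $(x;q)_n=(x;q)_\infty/(xq^n;q)_\infty$ ($1/(q;q)_n=0$ for $n<0$). $\mathcal S_n=\{\lambda\in\mathbb Z^n:\lambda_1\ge\dots\ge\lambda_n\}$, $\mathcal S_0=\{\varnothing\}$. $\mathbb G_N$: tuples $(\lambda^{(1)},\dots,\lambda^{(N)})$, $\lambda^{(n)}\in\mathcal S_n$, with $\lambda^{(m+1)}_{\ell+1}\le\lambda^{(m)}_\ell\le\lambda^{(m+1)}_\ell$. $P_{\lambda/\mu}(a)=a^{\sum_i\lambda_i-\sum_i\mu_i}\prod_{i=1}^{n-1}\frac{(q;q)_{\lambda_i-\lambda_{i+1}}}{(q;q)_{\lambda_i-\mu_i}(q;q)_{\mu_i-\lambda_{i+1}}}$, $P_{\lambda/\varnothing}(a)=a^{\lambda_1}$; $P_\lambda(x)=\sum\prod_jP_{\lambda^{(j)}/\lambda^{(j-1)}}(x_j)$ over $\mathbb G_N$ with $\lambda^{(N)}=\lambda$. $m_N^q(z)=\frac{1}{(2\pi i)^NN!}\prod_{i<j}(z_i/z_j;q)_\infty(z_j/z_i;q)_\infty$, $\Pi(z;\alpha,t)=\prod_{i,j}(\alpha_i/z_j;q)_\infty^{-1}\prod_je^{z_jt}$, $Q_\lambda(\alpha,t)=\prod_{i=1}^{N-1}(q^{\lambda_i-\lambda_{i+1}+1};q)_\infty\int_{\mathbb T^N}\prod_i\frac{dz_i}{z_i}P_\lambda(1/z)\Pi(z;\alpha,t)m_N^q(z)$,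 $\mathbb T$ the unit circle. Two-sided $q$-Whittaker process: $P_t(\underline\lambda_N)=\prod_{j=1}^NP_{\lambda^{(j)}/\lambda^{(j-1)}}(a_j)Q_{\lambda^{(N)}}(\alpha,t)/\Pi(a;\alpha,t)$. For $\underline\mu_N\in\mathbb G_N$ and $1\le j\le k\le N$, let $m_{jk}\ge0$ be the largest integer with $k+m_{jk}\le N$ and $\mu^{(k)}_j=\mu^{(k+1)}_j=\dots=\mu^{(k+m_{jk})}_j$; $\underline\mu^{jk+}_N$ is obtained from $\underline\mu_N$ by adding $1$ to $\mu^{(a)}_j$ for all $a\in\{k,\dots,k+m_{jk}\}$ (all other entries unchanged). *)

theory Defs
  imports "HOL-Analysis.Analysis"
begin

definition qpinf :: "real \<Rightarrow> complex \<Rightarrow> complex" where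
  "qpinf q x = prodinf (\<lambda>k. 1 - x * complex_of_real q ^ k)"

definition qpoch :: "real \<Rightarrow> complex \<Rightarrow> int \<Rightarrow> complex" where
  "qpoch q x n = qpinf q x / qpinf q (x * complex_of_real q powi n)"

definition qfac_inv :: "real \<Rightarrow> int \<Rightarrow> complex" where
  "qfac_inv q n = (if n < 0 then 0 else 1 / qpoch q (complex_of_real q) n)"

text \<open>Signatures lambda in S_n are functions nat => int, entries at indices 1..n.
  P_{lambda/mu}(x) for lambda in S_n, mu in S_(n-1) (n >= 1); for n = 1 this is x^(lambda_1).\<close>
definition Pskew :: "real \<Rightarrow> nat \<Rightarrow> (nat \<Rightarrow> int) \<Rightarrow> (nat \<Rightarrow> int) \<Rightarrow> complex \<Rightarrow> complex" where
  "Pskew q n lam mu x =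
     x powi (sum lam {1..n} - sum mu {1..n-1}) *
     (\<Prod>i\<in>{1..n-1}. qpoch q (complex_of_real q) (lam i - lam (Suc i))
                      * qfac_inv q (lam i - mu i) * qfac_inv q (mu i - lam (Suc i)))"

text \<open>Gelfand-Tsetlin patterns G_N: g n i = lambda^(n)_i for 1 <= i <= n <= N, zero elsewhere.\<close>
definition gt :: "nat \<Rightarrow> (nat \<Rightarrow> nat \<Rightarrow> int) set" where
  "gt N = {g. (\<forall>n i. \<not> (1 \<le> i \<and> i \<le> n \<and> n \<le> N) \<longrightarrow> g n i = 0)
            \<and> (\<forall>n\<in>{1..N}. \<forall>i\<in>{1..<n}. g n (Suc i) \<le> g n i)
            \<and> (\<forall>m\<in>{1..<N}. \<forall>l\<in>{1..m}. g (Suc m) (Suc l) \<le> g m l \<and> g m l \<le> g (Suc m) l)}"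

definition qW_P :: "real \<Rightarrow> nat \<Rightarrow> (nat \<Rightarrow> int) \<Rightarrow> (nat \<Rightarrow> complex) \<Rightarrow> complex" where
  "qW_P q N lam x = (\<Sum>g\<in>{g\<in>gt N. g N = lam}. \<Prod>j\<in>{1..N}. Pskew q j (g j) (g (j-1)) (x j))"

definition Pi_fn :: "real \<Rightarrow> nat \<Rightarrow> nat \<Rightarrow> (nat \<Rightarrow> real) \<Rightarrow> real \<Rightarrow> (nat \<Rightarrow> complex) \<Rightarrow> complex" where
  "Pi_fn q N M alpha t z =
     (\<Prod>i\<in>{1..M}. \<Prod>j\<in>{1..N}. inverse (qpinf q (complex_of_real (alpha i) / z j)))
     * (\<Prod>j\<in>{1..N}. exp (z j * complex_of_real t))"

definition mq :: "real \<Rightarrow> nat \<Rightarrow> (nat \<Rightarrow> complex) \<Rightarrow> complex" where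
  "mq q N z = 1 / ((2 * complex_of_real pi * \<i>) ^ N * of_nat (fact N))
     * (\<Prod>(i,j)\<in>{(i,j). 1 \<le> i \<and> i < j \<and> j \<le> N}. qpinf q (z i / z j) * qpinf q (z j / z i))"

text \<open>Torus integral  int_{T^N} prod_i dz_i/z_i F(z), via z_j = exp(i theta_j), dz_j/z_j = i dtheta_j.\<close>
definition torus_int :: "nat \<Rightarrow> ((nat \<Rightarrow> complex) \<Rightarrow> complex) \<Rightarrow> complex" where
  "torus_int N F = \<i> ^ N *
     integral\<^sup>L (PiM {1..N} (\<lambda>_. restrict_space lborel {0..2*pi})) (\<lambda>\<theta>. F (\<lambda>j. cis (\<theta> j)))"

definition Q_fn :: "real \<Rightarrow> nat \<Rightarrow> nat \<Rightarrow> (nat \<Rightarrow> real) \<Rightarrow> real \<Rightarrow> (nat \<Rightarrow> int) \<Rightarrow> complex" where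
  "Q_fn q N M alpha t lam =
     (\<Prod>i\<in>{1..N-1}. qpinf q (complex_of_real q powi (lam i - lam (Suc i) + 1)))
     * torus_int N (\<lambda>z. qW_P q N lam (\<lambda>j. 1 / z j) * Pi_fn q N M alpha t z * mq q N z)"

definition Pt :: "real \<Rightarrow> nat \<Rightarrow> nat \<Rightarrow> (nat \<Rightarrow> real) \<Rightarrow> (nat \<Rightarrow> real) \<Rightarrow> real
                  \<Rightarrow> (nat \<Rightarrow> nat \<Rightarrow> int) \<Rightarrow> complex" where
  "Pt q N M a alpha t g =
     (\<Prod>j\<in>{1..N}. Pskew q j (g j) (g (j-1)) (complex_of_real (a j)))
     * Q_fn q N M alpha t (g N) / Pi_fn q N M alpha t (\<lambda>j. complex_of_real (a j))"

definition mjk :: "nat \<Rightarrow> (nat \<Rightarrow> nat \<Rightarrow> int) \<Rightarrow> nat \<Rightarrow> nat \<Rightarrow> nat" where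
  "mjk N mu j k = (GREATEST m. k + m \<le> N \<and> (\<forall>b\<in>{k..k+m}. mu b j = mu k j))"

definition gt_plus :: "nat \<Rightarrow> (nat \<Rightarrow> nat \<Rightarrow> int) \<Rightarrow> nat \<Rightarrow> nat \<Rightarrow> (nat \<Rightarrow> nat \<Rightarrow> int)" where
  "gt_plus N mu j k = (\<lambda>n i. if i = j \<and> k \<le> n \<and> n \<le> k + mjk N mu j k then mu n i + 1 else mu n i)"

text \<open>Jump rates r_{jk}(mu), with mu^(i)_0 = +inf and mu^(i)_(i+1) = -inf, so that the
  corresponding factors (1 - q^(+inf)) equal 1: this happens exactly for j = 1 in the first
  factor and for j = k in the second and third factors.\<close>
definition rate :: "real \<Rightarrow> (nat \<Rightarrow> real) \<Rightarrow> (nat \<Rightarrow> nat \<Rightarrow> int) \<Rightarrow> nat \<Rightarrow> nat \<Rightarrow> real" where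
  "rate q a mu j k =
     a k * (if j = 1 then 1 else 1 - q powi (mu (k-1) (j-1) - mu k j))
         * (if j = k then 1 else 1 - q powi (mu k j - mu k (Suc j) + 1))
         / (if j = k then 1 else 1 - q powi (mu k j - mu (k-1) j + 1))"

definition gen :: "real \<Rightarrow> nat \<Rightarrow> (nat \<Rightarrow> real) \<Rightarrow> (nat \<Rightarrow> nat \<Rightarrow> int) \<Rightarrow> (nat \<Rightarrow> nat \<Rightarrow> int) \<Rightarrow> real" where
  "gen q N a mu lam = (\<Sum>k\<in>{1..N}. \<Sum>j\<in>{1..k}.
      rate q a mu j k * ((if lam = gt_plus N mu j k then 1 else 0) - (if lam = mu then 1 else 0)))"

end

theory Submission
  imports Defs
begin

text \<open>The torus integral is differentiated under the integral sign, which brings down the factor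
  \<open>z_1 + ... + z_N\<close>. The dual Pieri rule
  \<open>(\<Sum>j. 1 / x_j) P_lam(x) = \<Sum>i. (1 - q^(lam_i - lam_(i+1))) P_(lam - e_i)(x)\<close>, an induction over the
  branching rule, turns this into
  \<open>d/dt Q_lam = \<Sum>i. (1 - q^(lam_(i-1) - lam_i + 1)) Q_(lam - e_i)\<close>.

  On the other side, a pattern that jumps to \<open>lam\<close> lowers a constant run of \<open>lam\<close> within one column \<open>j\<close>,
  from its first row to some last row \<open>e\<close>. The rate times the ratio of the weights telescopes along the run.
  For \<open>e = N\<close> this is exactly the coefficient of \<open>Q_(lam - e_j)\<close> above. For \<open>e < N\<close> the top row is
  unchanged, and the inflow through all runs ending in row \<open>k - 1\<close>, together with \<open>a_k\<close>, balances the
  total outflow rate of row \<open>k\<close> by another telescoping sum.\<close>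

subsection \<open>The q-Pochhammer symbol\<close>

text \<open>Rates are indexed by the first row k of a jump, but the inflow is organised by its last
  row e: for given (j, e) at most one first row is possible, and the rate times the weight of the
  predecessor depends only on the target pattern, j and e. Hence the exchange of summation order in
  \<open>sum_triangle_swap\<close>.

  The prefactor of Q turns the Pieri coefficient for lowering lam_i, which looks at lam_(i+1), into
  one that looks at lam_(i-1). The telescoping along a run that reaches row N ends in that same
  factor. The constants a_k left over from the outflow add up to the logarithmic derivative of Pi(a;
  alpha, t), so the normalisation of the process absorbs them.

  The recurring obstacle is degeneracy: a lowered row may fail to be a signature, and factors 1 -
  q^0 appear. Ratios are therefore stated in cross-multiplied form, and each illegal move is matched
  with a vanishing coefficient (\<open>gap_below\<close>, \<open>qfac_inv\<close>,
  \<open>qpinf q 1\<close> or the rate itself), so that sums may run over all i, or over all j and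
  k.\<close>

locale q_param =
  fixes q :: real
  assumes q_pos: "0 < q" and q_less: "q < 1"
begin

abbreviation qc :: complex where "qc \<equiv> complex_of_real q"
abbreviation om :: "int \<Rightarrow> complex" where "om n \<equiv> 1 - qc powi n"

lemma q_nz [simp]: "q \<noteq> 0"
  using q_pos by simp

lemma qc_powi_add_1: "qc powi (n + 1) = qc powi n * qc"
  by (subst power_int_add) auto

lemma om_nz: "n \<noteq> 0 \<Longrightarrow> om n \<noteq> 0"
proof -
  assume n: "n \<noteq> 0"
  have "q powi n \<noteq> 1"
  proof (cases "n > 0")
    case True
    have "q powi n = q ^ nat n" using True by (simp add: power_int_def)
    moreover have "q ^ nat n < 1" using True q_pos q_less by (simp add: power_less_one_iff)
    ultimately show ?thesis by simp
  next
    case False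
    have "q powi n = inverse (q ^ nat (-n))" using False n
      by (simp add: power_int_def power_inverse)
    moreover have "q ^ nat (-n) < 1" using False n q_pos q_less by (simp add: power_less_one_iff)
    ultimately show ?thesis by simp
  qed
  then show "om n \<noteq> 0"
    by (metis eq_iff_diff_eq_0 of_real_1 of_real_eq_iff of_real_power_int)
qed

lemma summable_qpinf: "summable (\<lambda>k. norm (- (x * qc ^ k)))"
proof -
  have "summable (\<lambda>k. norm x * q ^ k)"
    using q_pos q_less by (intro summable_mult summable_geometric) auto
  then show ?thesis using q_pos by (simp add: norm_mult norm_power)
qed

lemma convergent_qpinf: "convergent_prod (\<lambda>k. 1 - x * qc ^ k)"
  using summable_qpinf[of x]
  by (intro abs_convergent_prod_imp_convergent_prod summable_imp_abs_convergent_prod) simp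

lemma qpinf_rec: "qpinf q x = (1 - x) * qpinf q (x * qc)"
proof -
  have "(\<lambda>k. 1 - x * qc ^ k) has_prod ((\<Prod>k<1. 1 - x * qc ^ k) * (\<Prod>k. 1 - x * qc ^ (k + 1)))"
    by (rule has_prod_ignore_initial_segment'[OF convergent_qpinf])
  then have "qpinf q x = (\<Prod>k<1. 1 - x * qc ^ k) * (\<Prod>k. 1 - x * qc ^ (k + 1))"
    unfolding qpinf_def using has_prod_unique by metis
  then show ?thesis by (simp add: qpinf_def mult.assoc)
qed

lemma qpinf_nz: "norm x < 1 \<Longrightarrow> qpinf q x \<noteq> 0"
  unfolding qpinf_def
proof (rule prodinf_nonzero[OF convergent_qpinf])
  fix i assume x: "norm x < 1"
  have "norm (x * qc ^ i) \<le> norm x * 1"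
    unfolding norm_mult norm_power using q_pos q_less
    by (intro mult_left_mono) (auto simp: power_le_one)
  then show "1 - x * qc ^ i \<noteq> 0" using x by auto
qed

lemma qpinf_1 [simp]: "qpinf q 1 = 0"
  by (subst qpinf_rec) simp

text \<open>The partial products converge uniformly on every ball, by comparison with a geometric
  series. Continuity on the whole plane makes \<open>qpinf q\<close> Borel measurable; the bounds on
  the torus use it on closed discs of radius at most 1.\<close>

lemma continuous_on_qpinf: "continuous_on UNIV (qpinf q)"
proof -
  have "continuous_on (cball 0 R) (qpinf q)" for R
  proof -
    let ?A = "cball (0::complex) R"
    have "uniformly_convergent_on ?A (\<lambda>N x. \<Sum>n<N. norm (- (x * qc ^ n)))"
    proof (rule Weierstrass_m_test')
      show "norm (norm (- (x * qc ^ n))) \<le> \<bar>R\<bar> * q ^ n" if "x \<in> ?A" for n x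
        using that q_pos by (auto simp: norm_mult norm_power intro!: mult_right_mono)
      show "summable (\<lambda>n. \<bar>R\<bar> * q ^ n)"
        using q_pos q_less by (intro summable_mult summable_geometric) auto
    qed
    then have "uniformly_convergent_on ?A (\<lambda>N x. \<Prod>n<N. 1 + (- (x * qc ^ n)))"
      by (intro uniformly_convergent_on_prod) (auto intro!: continuous_intros)
    then have "uniform_limit ?A (\<lambda>N x. \<Prod>n<N. 1 - x * qc ^ n)
                 (\<lambda>x. lim (\<lambda>N. \<Prod>n<N. 1 - x * qc ^ n)) sequentially"
      by (simp add: uniformly_convergent_uniform_limit_iff)
    moreover have "lim (\<lambda>N. \<Prod>n<N. 1 - x * qc ^ n) = qpinf q x" for x
    proof (rule limI)
      have "(\<lambda>N. \<Prod>n\<le>N. 1 - x * qc ^ n) \<longlonglongrightarrow> qpinf q x"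
        unfolding qpinf_def by (rule convergent_prod_LIMSEQ[OF convergent_qpinf])
      then have "(\<lambda>N. \<Prod>n<Suc N. 1 - x * qc ^ n) \<longlonglongrightarrow> qpinf q x"
        by (simp only: lessThan_Suc_atMost)
      then show "(\<lambda>N. \<Prod>n<N. 1 - x * qc ^ n) \<longlonglongrightarrow> qpinf q x"
        by (rule LIMSEQ_imp_Suc)
    qed
    ultimately have "uniform_limit ?A (\<lambda>N x. \<Prod>n<N. 1 - x * qc ^ n) (qpinf q) sequentially"
      by simp
    then show ?thesis
      by (rule uniform_limit_theorem[rotated]) (auto intro!: continuous_intros always_eventually)
  qed
  then have "isCont (qpinf q) x" for x
    by (rule continuous_on_interior[of "cball 0 (norm x + 1)"]) auto
  then show ?thesis by (simp add: continuous_at_imp_continuous_on)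
qed

lemma qpinf_powi_nz: "n > 0 \<Longrightarrow> qpinf q (qc powi n) \<noteq> 0"
proof (rule qpinf_nz)
  assume "n > 0"
  then show "norm (qc powi n) < 1"
    using q_pos q_less by (simp add: power_int_def norm_power power_less_one_iff)
qed

lemma qpinf_powi_rec: "qpinf q (qc powi n) = om n * qpinf q (qc powi (n + 1))"
  using qpinf_rec[of "qc powi n"] by (simp add: qc_powi_add_1)

lemma qpoch_eq: "qpoch q qc n = qpinf q qc / qpinf q (qc powi (n + 1))"
  by (simp add: qpoch_def qc_powi_add_1 mult.commute)

lemma qpoch_nz: "n \<ge> 0 \<Longrightarrow> qpoch q qc n \<noteq> 0"
  unfolding qpoch_eq using qpinf_powi_nz[of "n+1"] qpinf_powi_nz[of 1] by simp

lemma qpoch_rec: "n \<ge> 1 \<Longrightarrow> qpoch q qc n = om n * qpoch q qc (n - 1)"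
  using qpinf_powi_rec[of n] qpinf_powi_nz[of n] unfolding qpoch_eq
  by simp

text \<open>Valid for every integer: for \<open>n \<le> 0\<close> both sides vanish, so the Pieri rules below need no
  separate treatment of non-interlacing pairs.\<close>
lemma qfac_inv_rec: "qfac_inv q (n - 1) = om n * qfac_inv q n"
  using qpoch_rec[of n] om_nz[of n] qpoch_nz[of n]
  by (cases "n = 0") (auto simp: qfac_inv_def)

end

subsection \<open>Skew weights under unit steps\<close>

definition sig :: "nat \<Rightarrow> (nat \<Rightarrow> int) set" where
  "sig n = {lam. (\<forall>i. i \<notin> {1..n} \<longrightarrow> lam i = 0) \<and> (\<forall>i\<in>{1..<n}. lam (Suc i) \<le> lam i)}"

definition incr :: "nat \<Rightarrow> (nat \<Rightarrow> int) \<Rightarrow> nat \<Rightarrow> int" where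
  "incr i lam = lam(i := lam i + 1)"

definition decr :: "nat \<Rightarrow> (nat \<Rightarrow> int) \<Rightarrow> nat \<Rightarrow> int" where
  "decr i lam = lam(i := lam i - 1)"

lemma sum_decr: "finite A \<Longrightarrow> i \<in> A \<Longrightarrow> sum (decr i lam) A = sum lam A - 1"
  by (subst (1 2) sum.remove[of A i]) (auto simp: decr_def)

lemma sum_incr: "finite A \<Longrightarrow> i \<in> A \<Longrightarrow> sum (incr i lam) A = sum lam A + 1"
  by (subst (1 2) sum.remove[of A i]) (auto simp: incr_def)

context q_param
begin

text \<open>The case distinctions encode the conventions \<open>mu 0 = \<infinity>\<close> and \<open>lam (n + 1) = - \<infinity>\<close>.\<close>

definition gap_below :: "nat \<Rightarrow> (nat \<Rightarrow> int) \<Rightarrow> nat \<Rightarrow> complex" where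
  "gap_below n lam i = (if i = n then 1 else om (lam i - lam (Suc i)))"

definition gap_above :: "(nat \<Rightarrow> int) \<Rightarrow> (nat \<Rightarrow> int) \<Rightarrow> nat \<Rightarrow> complex" where
  "gap_above mu lam i = (if i = 1 then 1 else om (mu (i - 1) - lam i + 1))"

abbreviation Anum :: "nat \<Rightarrow> (nat \<Rightarrow> int) \<Rightarrow> complex" where
  "Anum n lam \<equiv> \<Prod>i\<in>{1..n-1}. qpoch q qc (lam i - lam (Suc i))"
abbreviation Bfac :: "nat \<Rightarrow> (nat \<Rightarrow> int) \<Rightarrow> (nat \<Rightarrow> int) \<Rightarrow> complex" where
  "Bfac n lam mu \<equiv> \<Prod>i\<in>{1..n-1}. qfac_inv q (lam i - mu i)"
abbreviation Cfac :: "nat \<Rightarrow> (nat \<Rightarrow> int) \<Rightarrow> (nat \<Rightarrow> int) \<Rightarrow> complex" where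
  "Cfac n lam mu \<equiv> \<Prod>i\<in>{1..n-1}. qfac_inv q (mu i - lam (Suc i))"

lemma Pskew_eq: "Pskew q n lam mu x =
   x powi (sum lam {1..n} - sum mu {1..n-1}) * Anum n lam * Bfac n lam mu * Cfac n lam mu"
  by (simp add: Pskew_def prod.distrib)

lemma prod_modify:
  fixes f g :: "'b \<Rightarrow> 'a::comm_monoid_mult"
  assumes "finite S" "k \<in> S" "\<And>i. i \<in> S - {k} \<Longrightarrow> f i = g i" "c * f k = d * g k"
  shows "c * prod f S = d * prod g S"
proof -
  have "prod f (S - {k}) = prod g (S - {k})" by (rule prod.cong) (use assms in auto)
  then show ?thesis using assms
    by (simp add: prod.remove[of S k] mult.assoc[symmetric])
qed

text \<open>Changing entry i of a signature affects only the factors at i and i - 1 of a product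
  over neighbouring differences. The corrections c and d stand on opposite sides, so nothing is
  divided and either may vanish; an index that falls outside \<open>S\<close> forces its correction
  to be 1.\<close>

lemma prod_shift_window:
  fixes f g :: "nat \<Rightarrow> complex"
  assumes "finite S" "i \<ge> 1" "\<And>n. n \<in> S - {i, i - 1} \<Longrightarrow> f n = g n"
    and "i \<in> S \<Longrightarrow> c * f i = g i" "i - 1 \<in> S \<Longrightarrow> f (i - 1) = d * g (i - 1)"
    and "i \<notin> S \<Longrightarrow> c = 1" "i - 1 \<notin> S \<Longrightarrow> d = 1"
  shows "c * prod f S = d * prod g S"
proof -
  define h where "h = (\<lambda>n. if n = i then g n else f n)"
  have "c * prod f S = 1 * prod h S"
  proof (cases "i \<in> S")
    case True
    then show ?thesis by (intro prod_modify[where k=i]) (use assms in \<open>auto simp: h_def\<close>)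
  next
    case False
    then have "prod f S = prod h S" by (intro prod.cong) (auto simp: h_def)
    then show ?thesis using False assms by simp
  qed
  moreover have "1 * prod h S = d * prod g S"
  proof (cases "i - 1 \<in> S")
    case True
    then show ?thesis by (intro prod_modify[where k="i-1"]) (use assms in \<open>auto simp: h_def\<close>)
  next
    case False
    then have "prod h S = prod g S" using assms(3) by (intro prod.cong) (auto simp: h_def)
    then show ?thesis using False assms by simp
  qed
  ultimately show ?thesis by simp
qed

text \<open>\<open>qpoch_rec\<close> needs an index of at least 1. Strict descent after i and weak
  descent before i supply exactly this for the two factors that change.\<close>

lemma Anum_decr:
  assumes "i \<in> {1..n}" "i < n \<Longrightarrow> lam (Suc i) < lam i" 
    and "i > 1 \<Longrightarrow> lam i \<le> lam (i - 1)"
  shows "gap_below n lam i * Anum n (decr i lam) = gap_above lam lam i * Anum n lam"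
proof (rule prod_shift_window[where i=i])
  assume i: "i \<in> {1..n - 1}"
  then have "lam (Suc i) < lam i" using assms(2) by auto
  then show "gap_below n lam i * qpoch q qc (decr i lam i - decr i lam (Suc i)) =
    qpoch q qc (lam i - lam (Suc i))"
    using i qpoch_rec[of "lam i - lam (Suc i)"]
    by (auto simp: gap_below_def decr_def algebra_simps)
next
  assume i: "i - 1 \<in> {1..n - 1}"
  have *: "Suc (i - Suc 0) = i" using i by auto
  have "lam i \<le> lam (i - 1)" using assms(3) i by auto
  then show "qpoch q qc (decr i lam (i - 1) - decr i lam (Suc (i - 1))) =
    gap_above lam lam i * qpoch q qc (lam (i - 1) - lam (Suc (i - 1)))"
    using i qpoch_rec[of "lam (i-1) - lam i + 1"]
    by (auto simp: gap_above_def decr_def algebra_simps *)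
qed (use assms in \<open>auto simp: decr_def gap_below_def gap_above_def\<close>)

lemma Bfac_decr:
  assumes "i \<in> {1..n}"
  shows "Bfac n (decr i lam) mu = (if i = n then 1 else om (lam i - mu i)) * Bfac n lam mu"
proof (cases "i = n")
  case True
  then show ?thesis by (auto simp: decr_def intro!: prod.cong)
next
  case False
  then have "1 * Bfac n (decr i lam) mu = om (lam i - mu i) * Bfac n lam mu"
    using assms qfac_inv_rec[of "lam i - mu i"]
    by (intro prod_modify[where k=i]) (auto simp: decr_def algebra_simps)
  with False show ?thesis by simp
qed

lemma Cfac_decr:
  assumes "i \<in> {1..n}"
  shows "gap_above mu lam i * Cfac n (decr i lam) mu = Cfac n lam mu"
proof (cases "i = 1")
  case True
  then show ?thesis by (auto simp: decr_def gap_above_def intro!: prod.cong)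
next
  case False
  then have "Suc (i - Suc 0) = i" using assms by auto
  then have "gap_above mu lam i * Cfac n (decr i lam) mu = 1 * Cfac n lam mu"
    using assms False qfac_inv_rec[of "mu (i-1) - lam i + 1"]
    by (intro prod_modify[where k="i-1"]) (auto simp: decr_def gap_above_def algebra_simps)
  then show ?thesis by simp
qed

text \<open>Dividing the multipliers on the left by the last factor on the right gives the jump rate
  in the form of \<open>rate_run_lowered\<close>, which explains the arrangement.\<close>

lemma Pskew_decr_upper:
  assumes "i \<in> {1..n}" "i < n \<Longrightarrow> lam (Suc i) < lam i"
    and "i > 1 \<Longrightarrow> lam i \<le> lam (i - 1)" and "x \<noteq> 0"
  shows "Pskew q n (decr i lam) mu x * x * gap_below n lam i * gap_above mu lam i =
     Pskew q n lam mu x * gap_above lam lam i * (if i = n then 1 else om (lam i - mu i))"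
proof -
  let ?s = "sum lam {1..n} - sum mu {1..n-1}"
  have p: "x powi (sum (decr i lam) {1..n} - sum mu {1..n-1}) * x = x powi ?s"
  proof -
    have "sum (decr i lam) {1..n} - sum mu {1..n-1} = ?s - 1"
      using assms by (simp add: sum_decr)
    then show ?thesis using assms power_int_add_1[of x "?s - 1"] by (simp only:) simp
  qed
  have a: "gap_below n lam i * Anum n (decr i lam) = gap_above lam lam i * Anum n lam"
    by (rule Anum_decr) (use assms in auto)
  have "Pskew q n (decr i lam) mu x * x * gap_below n lam i * gap_above mu lam i =
    (x powi (sum (decr i lam) {1..n} - sum mu {1..n-1}) * x) *
    (gap_below n lam i * Anum n (decr i lam)) * Bfac n (decr i lam) mu *
    (gap_above mu lam i * Cfac n (decr i lam) mu)"
    unfolding Pskew_eq by (simp only: mult_ac)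
  also have "\<dots> = x powi ?s * (gap_above lam lam i * Anum n lam) *
     ((if i = n then 1 else om (lam i - mu i)) * Bfac n lam mu) * Cfac n lam mu"
    unfolding p a Bfac_decr[OF assms(1)] Cfac_decr[OF assms(1)] ..
  finally show ?thesis unfolding Pskew_eq by (simp only: mult_ac)
qed

lemma Pskew_decr_lower:
  assumes "i \<in> {1..<n}" and "x \<noteq> 0"
  shows "Pskew q n lam (decr i mu) x * om (lam i - mu i + 1) =
     x * Pskew q n lam mu x * om (mu i - lam (Suc i))"
proof -
  let ?s = "sum lam {1..n} - sum mu {1..n-1}"
  have p: "x powi (sum lam {1..n} - sum (decr i mu) {1..n-1}) = x powi ?s * x"
  proof -
    have "i \<in> {1..n-1}" using assms by auto
    then have "sum lam {1..n} - sum (decr i mu) {1..n-1} = ?s + 1"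
      by (subst sum_decr) auto
    then show ?thesis using assms power_int_add_1[of x "?s"] by (simp only:) simp
  qed
  have b: "om (lam i - mu i + 1) * Bfac n lam (decr i mu) = 1 * Bfac n lam mu"
    using assms qfac_inv_rec[of "lam i - mu i + 1"]
    by (intro prod_modify[where k=i]) (auto simp: decr_def algebra_simps)
  have c: "1 * Cfac n lam (decr i mu) = om (mu i - lam (Suc i)) * Cfac n lam mu"
    using assms qfac_inv_rec[of "mu i - lam (Suc i)"]
    by (intro prod_modify[where k=i]) (auto simp: decr_def algebra_simps)
  have "Pskew q n lam (decr i mu) x * om (lam i - mu i + 1) =
     x powi (sum lam {1..n} - sum (decr i mu) {1..n-1}) * Anum n lam *
     (om (lam i - mu i + 1) * Bfac n lam (decr i mu)) * (1 * Cfac n lam (decr i mu))"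
    unfolding Pskew_eq by (simp only: mult_ac mult_1)
  also have "\<dots> = x powi ?s * x * Anum n lam * (1 * Bfac n lam mu) * (om (mu i - lam (Suc i)) * Cfac n lam mu)"
    unfolding p b c ..
  finally show ?thesis unfolding Pskew_eq by (simp only: mult_ac mult_1)
qed

text \<open>The weight itself detects a failure of interlacing, through 1/(q;q)_n = 0 for n < 0.
  This allows sums over index sets larger than the set of interlacing rows.\<close>

lemma Pskew_eq_0:
  assumes "i \<in> {1..<n}" "\<not> (lam (Suc i) \<le> mu i \<and> mu i \<le> lam i)"
  shows "Pskew q n lam mu x = 0"
proof -
  have "qfac_inv q (lam i - mu i) * qfac_inv q (mu i - lam (Suc i)) = 0"
    using assms by (auto simp: qfac_inv_def)
  then show ?thesis using assms unfolding Pskew_def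
    by (auto intro!: prod_zero bexI[of _ i])
qed

end

subsection \<open>Branching of patterns and the Pieri rule\<close>

lemma sig_decr:
  assumes "lam \<in> sig n" "i \<in> {1..n}" "i < n \<Longrightarrow> lam (Suc i) < lam i"
  shows "decr i lam \<in> sig n"
  using assms by (force simp: sig_def decr_def)

lemma incr_decr [simp]: "incr i (decr i lam) = lam" "decr i (incr i lam) = lam"
  by (auto simp: incr_def decr_def)

definition interlacing :: "nat \<Rightarrow> (nat \<Rightarrow> int) \<Rightarrow> (nat \<Rightarrow> int) set" where
  "interlacing n lam = {mu. (\<forall>i. i \<notin> {1..n} \<longrightarrow> mu i = 0) \<and>
     (\<forall>i\<in>{1..n}. lam (Suc i) \<le> mu i \<and> mu i \<le> lam i)}"

text \<open>Slack c = 0 bounds the rows interlacing with \<open>lam\<close>; c = 1 also covers the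
  rows interlacing with any \<open>decr i lam\<close>.\<close>

lemma finite_sig_box:
  "finite {mu. (\<forall>i. i \<notin> {1..n} \<longrightarrow> mu i = 0) \<and> (\<forall>i\<in>{1..n}. lam (Suc i) - c \<le> mu i \<and> mu i \<le> lam i)}"
  for lam :: "nat \<Rightarrow> int"
proof (rule finite_subset)
  let ?B = "\<Union>i\<in>{1..n}. {lam (Suc i) - c..lam i}"
  show "finite {mu. \<forall>i. (i \<in> {1..n} \<longrightarrow> mu i \<in> ?B) \<and> (i \<notin> {1..n} \<longrightarrow> mu i = 0)}"
    by (intro finite_set_of_finite_funs) auto
qed force

lemma finite_interlacing: "finite (interlacing n lam)"
  using finite_sig_box[of n lam 0] by (simp add: interlacing_def)

lemma interlacing_subset_sig: "interlacing n lam \<subseteq> sig n"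
proof
  fix mu assume mu: "mu \<in> interlacing n lam"
  have "mu (Suc i) \<le> mu i" if "i \<in> {1..<n}" for i
  proof -
    have "mu (Suc i) \<le> lam (Suc i)" "lam (Suc i) \<le> mu i"
      using mu that by (auto simp: interlacing_def)
    then show ?thesis by simp
  qed
  then show "mu \<in> sig n" using mu by (auto simp: sig_def interlacing_def)
qed

lemma gt_sig: "g \<in> gt N \<Longrightarrow> n \<le> N \<Longrightarrow> g n \<in> sig n"
  by (cases "n = 0") (auto simp: gt_def sig_def)

lemma gt_interlacing: "g \<in> gt (Suc N) \<Longrightarrow> g N \<in> interlacing N (g (Suc N))"
  by (cases "N = 0") (auto simp: gt_def interlacing_def)

lemma gt_drop: "g \<in> gt (Suc N) \<Longrightarrow> g(Suc N := (\<lambda>_. 0)) \<in> gt N"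
  by (auto simp: gt_def)

lemma gt_extend:
  assumes "h \<in> gt N" "lam \<in> sig (Suc N)" "h N \<in> interlacing N lam"
  shows "h(Suc N := lam) \<in> gt (Suc N)"
  using assms unfolding gt_def sig_def interlacing_def
  by (auto simp: le_Suc_eq less_Suc_eq)

lemma gt_fibre_bij:
  assumes "lam \<in> sig (Suc N)"
  shows "bij_betw (\<lambda>(mu, h). h(Suc N := lam)) (SIGMA mu:interlacing N lam. {h \<in> gt N. h N = mu})
           {g \<in> gt (Suc N). g (Suc N) = lam}"
proof (rule bij_betw_byWitness[where f' = "\<lambda>g. (g N, g(Suc N := (\<lambda>_. 0)))"])
  show "\<forall>p\<in>SIGMA mu:interlacing N lam. {h \<in> gt N. h N = mu}.
       (\<lambda>g. (g N, g(Suc N := (\<lambda>_. 0)))) (case p of (mu, h) \<Rightarrow> h(Suc N := lam)) = p"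
    by (auto simp: gt_def fun_eq_iff)
  show "\<forall>g\<in>{g \<in> gt (Suc N). g (Suc N) = lam}.
       (case (g N, g(Suc N := (\<lambda>_. 0))) of (mu, h) \<Rightarrow> h(Suc N := lam)) = g"
    by auto
  show "(\<lambda>(mu, h). h(Suc N := lam)) ` (SIGMA mu:interlacing N lam. {h \<in> gt N. h N = mu})
    \<subseteq> {g \<in> gt (Suc N). g (Suc N) = lam}"
    using gt_extend[OF _ assms] by auto
  show "(\<lambda>g. (g N, g(Suc N := (\<lambda>_. 0)))) ` {g \<in> gt (Suc N). g (Suc N) = lam}
    \<subseteq> (SIGMA mu:interlacing N lam. {h \<in> gt N. h N = mu})"
    using gt_drop gt_interlacing by fastforce
qed

text \<open>Interlacing leaves finitely many choices for each lower row. Without finiteness the sum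
  in \<open>qW_P\<close> would take the default value 0.\<close>

lemma finite_gt_fibre: "finite {g \<in> gt N. g N = lam}"
proof (induction N arbitrary: lam)
  case 0
  show ?case by (rule finite_subset[of _ "{\<lambda>_ _. 0}"]) (auto simp: gt_def fun_eq_iff)
next
  case (Suc N)
  show ?case
  proof (cases "lam \<in> sig (Suc N)")
    case True
    have "finite (SIGMA mu:interlacing N lam. {h \<in> gt N. h N = mu})"
      using Suc finite_interlacing by (intro finite_SigmaI) auto
    then show ?thesis using bij_betw_finite[OF gt_fibre_bij[OF True]] by simp
  next
    case False
    then have "{g \<in> gt (Suc N). g (Suc N) = lam} = {}" using gt_sig by fastforce
    then show ?thesis by (simp only: finite.emptyI)
  qed
qed

lemma sum_Suc_split: "(\<Sum>i\<in>{1..Suc n}. f i) = f 1 + (\<Sum>i\<in>{1..n}. f (Suc i))"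
  for f :: "nat \<Rightarrow> 'a::comm_monoid_add"
  by (induction n) (auto simp: add.assoc)

section \<open>The branching rule and the dual Pieri rule for q-Whittaker polynomials\<close>

context q_param
begin

text \<open>The freedom in \<open>U\<close> lets \<open>lam\<close> and all its lowerings
  \<open>decr i lam\<close> be expanded over one common index set. The surplus terms vanish by
  \<open>Pskew_eq_0\<close>.\<close>

lemma qW_P_Suc:
  assumes lam: "lam \<in> sig (Suc N)" and U: "finite U" "interlacing N lam \<subseteq> U" "U \<subseteq> sig N"
  shows "qW_P q (Suc N) lam x = (\<Sum>mu\<in>U. Pskew q (Suc N) lam mu (x (Suc N)) * qW_P q N mu x)"
proof -
  let ?w = "\<lambda>n g. \<Prod>j\<in>{1..n}. Pskew q j (g j) (g (j-1)) (x j)"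
  have "qW_P q (Suc N) lam x =
      (\<Sum>(mu, h)\<in>(SIGMA mu:interlacing N lam. {h \<in> gt N. h N = mu}). ?w (Suc N) (h(Suc N := lam)))"
    unfolding qW_P_def
    by (subst sum.reindex_bij_betw[OF gt_fibre_bij[OF lam], symmetric]) (auto intro!: sum.cong)
  also have "\<dots> = (\<Sum>mu\<in>interlacing N lam. \<Sum>h\<in>{h \<in> gt N. h N = mu}. ?w (Suc N) (h(Suc N := lam)))"
    by (intro sum.Sigma[symmetric] ballI finite_interlacing finite_gt_fibre)
  also have "\<dots> = (\<Sum>mu\<in>interlacing N lam. \<Sum>h\<in>{h \<in> gt N. h N = mu}. Pskew q (Suc N) lam mu (x (Suc N)) * ?w N h)"
  proof (intro sum.cong refl)
    fix mu h assume h: "h \<in> {h \<in> gt N. h N = mu}"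
    have "?w N (h(Suc N := lam)) = ?w N h" by (rule prod.cong) auto
    then show "?w (Suc N) (h(Suc N := lam)) = Pskew q (Suc N) lam mu (x (Suc N)) * ?w N h"
      using h by (simp add: prod.nat_ivl_Suc' mult.commute)
  qed
  also have "\<dots> = (\<Sum>mu\<in>interlacing N lam. Pskew q (Suc N) lam mu (x (Suc N)) * qW_P q N mu x)"
    unfolding qW_P_def by (simp add: sum_distrib_left)
  also have "\<dots> = (\<Sum>mu\<in>U. Pskew q (Suc N) lam mu (x (Suc N)) * qW_P q N mu x)"
  proof (rule sum.mono_neutral_left[OF U(1,2)], intro ballI)
    fix mu assume mu: "mu \<in> U - interlacing N lam"
    then have "\<forall>i. i \<notin> {1..N} \<longrightarrow> mu i = 0" using U(3) by (auto simp: sig_def)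
    then obtain i where "i \<in> {1..N}" "\<not> (lam (Suc i) \<le> mu i \<and> mu i \<le> lam i)"
      using mu by (auto simp: interlacing_def)
    then show "Pskew q (Suc N) lam mu (x (Suc N)) * qW_P q N mu x = 0"
      by (subst Pskew_eq_0[of i]) auto
  qed
  finally show ?thesis .
qed

text \<open>This identity is used twice: for the Pieri rule, with a, c from the upper row and b, d
  from the lower one, and for the outflow in \<open>sum_rates\<close>, with the two rows
  exchanged.\<close>

lemma telescoping_identity:
  "om (a - c + 1) * (1 - qc powi (c - d)) - om (b + 1 - d) * (1 - qc powi (a - b)) =
     (qc powi (a - b) - qc powi (c - d)) * om (b - c + 1)"
  by (simp add: power_int_diff power_int_add field_simps)

text \<open>The limit d -> -infinity of \<open>telescoping_identity\<close>, for the end of a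
  row.\<close>

lemma telescoping_identity_last:
  "om (a - c + 1) - (1 - qc powi (a - b)) = qc powi (a - b) * om (b - c + 1)"
  by (simp add: power_int_diff power_int_add field_simps)

text \<open>Holding for every i in 1..n, even when \<open>decr i lam\<close> is no signature, it
  lets \<open>skew_Pieri\<close> sum over all i without side conditions.\<close>

lemma gap_below_decr_Pskew:
  assumes lam: "lam \<in> sig n" and i: "i \<in> {1..n}" and x: "x \<noteq> 0"
  shows "gap_below n lam i * Pskew q n (decr i lam) mu x =
    x powi (sum lam {1..n} - sum mu {1..n-1} - 1) * Anum n lam * Bfac n lam mu *
      gap_above lam lam i * (if i = n then 1 else om (lam i - mu i)) * Cfac n (decr i lam) mu"
proof (cases "i < n \<longrightarrow> lam (Suc i) < lam i")
  case True
  have a: "gap_below n lam i * Anum n (decr i lam) = gap_above lam lam i * Anum n lam"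
  proof (rule Anum_decr)
    show "lam i \<le> lam (i - 1)" if "i > 1"
      using lam i that unfolding sig_def by (auto dest!: bspec[of _ _ "i - 1"])
  qed (use True i in auto)
  have "sum (decr i lam) {1..n} - sum mu {1..n-1} = sum lam {1..n} - sum mu {1..n-1} - 1"
    using i by (simp add: sum_decr)
  then have "gap_below n lam i * Pskew q n (decr i lam) mu x =
    x powi (sum lam {1..n} - sum mu {1..n-1} - 1) * (gap_below n lam i * Anum n (decr i lam)) *
      Bfac n (decr i lam) mu * Cfac n (decr i lam) mu"
    unfolding Pskew_eq by (simp only: mult_ac)
  then show ?thesis unfolding a Bfac_decr[OF i] by (simp only: mult_ac)
next
  case False
  \<comment> \<open>Here \<open>decr i lam\<close> is not a signature. The left side vanishes since
    \<open>gap_below\<close> is 0. The right side vanishes through \<open>Cfac\<close> if mu_i <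
    lam_i, through \<open>om 0\<close> if mu_i = lam_i, and through \<open>Bfac\<close> if mu_i >
    lam_i.\<close>
  then have i': "i \<in> {1..<n}" and eq: "lam (Suc i) = lam i"
    using lam i by (auto simp: sig_def order.antisym not_less)
  have "Pskew q n (decr i lam) mu x = 0"
    using i' by (rule Pskew_eq_0) (auto simp: decr_def eq)
  have "om (lam i - mu i) * Bfac n lam mu * Cfac n (decr i lam) mu = 0"
  proof (cases "mu i < lam i")
    case True
    then have "Cfac n (decr i lam) mu = 0"
      using i' eq by (auto intro!: prod_zero bexI[of _ i] simp: qfac_inv_def decr_def)
    then show ?thesis by simp
  next
    case False
    show ?thesis
    proof (cases "mu i = lam i")
      case False
      with \<open>\<not> mu i < lam i\<close> have "Bfac n lam mu = 0"
        using i' by (auto intro!: prod_zero bexI[of _ i] simp: qfac_inv_def)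
      then show ?thesis by simp
    qed simp
  qed
  moreover have "gap_below n lam i = 0" using i' by (simp add: gap_below_def eq)
  ultimately show ?thesis using i' by (auto simp: mult_ac)
qed

text \<open>After extracting the common factors, the difference of the \<open>(i + 1)\<close>-st term on the left and
  the \<open>i\<close>-th term on the right is a telescoping difference of \<open>u i = q powi (lam i - mu i)\<close>.\<close>
lemma skew_Pieri:
  assumes lam: "lam \<in> sig (Suc N)" and x: "x \<noteq> 0"
  shows "(\<Sum>i\<in>{1..Suc N}. gap_below (Suc N) lam i * Pskew q (Suc N) (decr i lam) mu x) =
    inverse x * Pskew q (Suc N) lam mu x +
    (\<Sum>i\<in>{1..N}. gap_below N (incr i mu) i * Pskew q (Suc N) lam (incr i mu) x)"
proof -
  define n where "n = Suc N"
  define s where "s = sum lam {1..n} - sum mu {1..n-1}"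
  define K where "K = x powi (s - 1) * Anum n lam * Bfac n lam mu"
  define C where "C = Cfac n lam mu"
  define E where "E = (\<lambda>i. Cfac n (decr i lam) mu)"
  \<comment> \<open>The value 0 at n makes 1 - u n equal to 1, which matches the missing
    \<open>Bfac\<close> factor at i = n, and makes the upper end of the telescoping sum
    vanish.\<close>
  define u where "u = (\<lambda>i. if i = n then 0 else qc powi (lam i - mu i))"
  have lhs: "gap_below n lam i * Pskew q n (decr i lam) mu x = K * (gap_above lam lam i * (1 - u i) * E i)"
    if "i \<in> {1..n}" for i
    using gap_below_decr_Pskew[of lam n i x mu] lam x that
    by (simp add: n_def K_def s_def u_def E_def mult_ac)
  have rhs: "gap_below N (incr i mu) i * Pskew q n lam (incr i mu) x =
      K * (gap_below N (incr i mu) i * (1 - u i) * E (Suc i))" if i: "i \<in> {1..N}" for i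
  proof -
    have s: "sum lam {1..n} - sum (incr i mu) {1..n-1} = s - 1"
      using i unfolding s_def n_def by (subst sum_incr) auto
    have "1 * Bfac n lam (incr i mu) = om (lam i - mu i) * Bfac n lam mu"
      using i qfac_inv_rec[of "lam i - mu i"] 
      by (intro prod_modify[where k=i]) (auto simp: incr_def n_def algebra_simps)
    \<comment> \<open>Raising mu_i and lowering lam_(i+1) change the difference mu_i - lam_(i+1) in
      the same way. This is what pairs term i on the right with term i + 1 on the left.\<close>
    moreover have "Cfac n lam (incr i mu) = E (Suc i)"
      unfolding E_def by (rule prod.cong) (auto simp: incr_def decr_def algebra_simps)
    ultimately show ?thesis
      unfolding Pskew_eq s K_def using i by (simp add: u_def n_def mult_ac)
  qed
  have E: "om (mu i - lam (Suc i) + 1) * E (Suc i) = C" if "i \<in> {1..N}" for i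
    using Cfac_decr[of "Suc i" n mu lam] that by (simp add: E_def C_def gap_above_def n_def)
  have step: "gap_above lam lam (Suc i) * (1 - u (Suc i)) * E (Suc i)
      - gap_below N (incr i mu) i * (1 - u i) * E (Suc i) = (u i - u (Suc i)) * C"
    if i: "i \<in> {1..N}" for i
  proof -
    have "gap_above lam lam (Suc i) * (1 - u (Suc i)) - gap_below N (incr i mu) i * (1 - u i)
      = (u i - u (Suc i)) * om (mu i - lam (Suc i) + 1)"
    proof (cases "i = N")
      case True
      then show ?thesis using i telescoping_identity_last[of "lam N" "lam (Suc N)" "mu N"]
        by (simp add: gap_above_def gap_below_def u_def n_def)
    next
      case False
      then show ?thesis
        using i telescoping_identity[of "lam i" "lam (Suc i)" "mu (Suc i)" "mu i"]
        by (simp add: gap_above_def gap_below_def u_def n_def incr_def)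
    qed
    then show ?thesis unfolding E[OF i, symmetric]
      by (metis (no_types, lifting) left_diff_distrib mult.assoc)
  qed
  have "(\<Sum>i\<in>{1..N}. (u i - u (Suc i))) = u 1 - u (Suc N)"
    by (induction N) auto
  then have tel: "(\<Sum>i\<in>{1..N}. (u i - u (Suc i))) = u 1" by (simp add: u_def n_def)
  \<comment> \<open>The unpaired first term contributes (1 - u 1) * C and the telescoping sum u 1 *
    C. Together they give C, which is the term with \<open>inverse x\<close>.\<close>
  have C1: "gap_above lam lam 1 * E 1 = C"
    using Cfac_decr[of 1 n mu lam] by (simp add: E_def C_def gap_above_def n_def)
  have "(\<Sum>i\<in>{1..n}. gap_above lam lam i * (1 - u i) * E i)
     = gap_above lam lam 1 * (1 - u 1) * E 1 +
       (\<Sum>i\<in>{1..N}. gap_above lam lam (Suc i) * (1 - u (Suc i)) * E (Suc i))"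
    unfolding n_def by (rule sum_Suc_split)
  also have "\<dots> = (1 - u 1) * C + (\<Sum>i\<in>{1..N}. (u i - u (Suc i)) * C + gap_below N (incr i mu) i * (1 - u i) * E (Suc i))"
  proof -
    have "gap_above lam lam 1 * (1 - u 1) * E 1 = (1 - u 1) * C"
      unfolding C1[symmetric] by (simp only: mult_ac)
    moreover have "(\<Sum>i\<in>{1..N}. gap_above lam lam (Suc i) * (1 - u (Suc i)) * E (Suc i)) =
       (\<Sum>i\<in>{1..N}. (u i - u (Suc i)) * C + gap_below N (incr i mu) i * (1 - u i) * E (Suc i))"
      using step by (intro sum.cong refl) (simp add: diff_eq_eq)
    ultimately show ?thesis by simp
  qed
  also have "\<dots> = C + (\<Sum>i\<in>{1..N}. gap_below N (incr i mu) i * (1 - u i) * E (Suc i))"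
    unfolding sum.distrib sum_distrib_right[symmetric] tel by (simp add: algebra_simps)
  finally have main: "(\<Sum>i\<in>{1..n}. gap_above lam lam i * (1 - u i) * E i)
    = C + (\<Sum>i\<in>{1..N}. gap_below N (incr i mu) i * (1 - u i) * E (Suc i))" .
  have KC: "inverse x * Pskew q n lam mu x = K * C"
    using power_int_add_1[of x "s - 1"] x
    unfolding Pskew_eq K_def C_def s_def[symmetric] by (simp add: field_simps)
  have "(\<Sum>i\<in>{1..n}. gap_below n lam i * Pskew q n (decr i lam) mu x) =
    K * (\<Sum>i\<in>{1..n}. gap_above lam lam i * (1 - u i) * E i)"
    by (simp add: lhs sum_distrib_left)
  also have "\<dots> = inverse x * Pskew q n lam mu x +
     (\<Sum>i\<in>{1..N}. K * (gap_below N (incr i mu) i * (1 - u i) * E (Suc i)))"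
    unfolding main KC by (simp add: distrib_left sum_distrib_left)
  also have "(\<Sum>i\<in>{1..N}. K * (gap_below N (incr i mu) i * (1 - u i) * E (Suc i))) =
     (\<Sum>i\<in>{1..N}. gap_below N (incr i mu) i * Pskew q n lam (incr i mu) x)"
    by (intro sum.cong refl rhs[symmetric])
  finally show ?thesis by (simp only: n_def)
qed


text \<open>When \<open>skew_Pieri\<close> is summed against the polynomials in one variable less,
  the raised row \<open>incr i mu\<close> is taken as the new summation variable \<open>nu\<close>,
  and the polynomial attached to it becomes the one of \<open>decr i nu\<close>. The sum over i is
  then the induction hypothesis at \<open>nu\<close>.\<close>

lemma qW_P_Pieri:
  assumes "lam \<in> sig N" "\<And>j. j \<in> {1..N} \<Longrightarrow> x j \<noteq> 0"
  shows "(\<Sum>j\<in>{1..N}. inverse (x j)) * qW_P q N lam x =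
    (\<Sum>i\<in>{1..N}. gap_below N lam i * qW_P q N (decr i lam) x)"
  using assms
proof (induction N arbitrary: lam)
  case 0
  then show ?case by simp
next
  case (Suc N)
  define y where "y = x (Suc N)"
  define P where "P = (\<lambda>mu. qW_P q N mu x)"
  define S where "S = (\<lambda>lam mu. Pskew q (Suc N) lam mu y)"
  \<comment> \<open>Lowering a part of \<open>lam\<close> can relax the lower bound on
    \<open>mu\<close> by 1, and so can passing from an interlacing \<open>nu\<close> to
    \<open>decr i nu\<close>; hence the slack.\<close>
  define U where "U = {mu \<in> sig N. \<forall>i\<in>{1..N}. lam (Suc i) - 1 \<le> mu i \<and> mu i \<le> lam i}"
  have y: "y \<noteq> 0" using Suc.prems(2) by (simp add: y_def)
  have fin: "finite U"
    by (rule finite_subset[OF _ finite_sig_box[of N lam 1]]) (auto simp: U_def sig_def)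
  have Usig: "U \<subseteq> sig N" by (auto simp: U_def)
  have branch: "qW_P q (Suc N) nu x = (\<Sum>mu\<in>U. S nu mu * P mu)"
    if "nu \<in> sig (Suc N)" "interlacing N nu \<subseteq> U" for nu
    using qW_P_Suc[OF that(1) fin that(2) Usig] by (simp add: S_def P_def y_def)
  have int0: "interlacing N lam \<subseteq> U"
    using interlacing_subset_sig[of N lam] by (force simp: U_def interlacing_def)
  have int1: "interlacing N (decr i lam) \<subseteq> U" for i
  proof
    fix mu assume mu: "mu \<in> interlacing N (decr i lam)"
    have "lam (Suc l) - 1 \<le> mu l \<and> mu l \<le> lam l" if "l \<in> {1..N}" for l
    proof -
      have "decr i lam (Suc l) \<le> mu l" "mu l \<le> decr i lam l"
        using mu that by (auto simp: interlacing_def)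
      then show ?thesis by (auto simp: decr_def split: if_splits)
    qed
    then show "mu \<in> U" using mu interlacing_subset_sig by (auto simp: U_def)
  qed
  have S_nz: "lam (Suc i) \<le> mu i \<and> mu i \<le> lam i" if "S lam mu \<noteq> 0" "i \<in> {1..N}" for mu i
    using Pskew_eq_0[of i "Suc N" lam mu y] that by (auto simp: S_def)
  \<comment> \<open>\<open>U\<close> is not closed under raising or lowering, so only nonzero terms
    are matched: a nonzero \<open>S lam nu\<close> forces \<open>nu\<close> to interlace with
    \<open>lam\<close>, and a nonzero \<open>gap_below N nu i\<close> forces
    \<open>decr i nu\<close> to be a signature.\<close>
  have shift: "(\<Sum>mu\<in>U. gap_below N (incr i mu) i * S lam (incr i mu) * P mu) =
    (\<Sum>nu\<in>U. gap_below N nu i * S lam nu * P (decr i nu))" (is "sum ?g U = sum ?h U")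
    if i: "i \<in> {1..N}" for i
  proof (rule sum.reindex_bij_witness_not_neutral[where i="decr i" and j="incr i"
        and S' = "{a \<in> U. ?g a = 0}" and T' = "{a \<in> U. ?h a = 0}"])
    fix mu assume mu: "mu \<in> U - {a \<in> U. ?g a = 0}"
    then have nz: "?g mu \<noteq> 0" by blast
    then have l: "lam (Suc l) \<le> incr i mu l \<and> incr i mu l \<le> lam l" if "l \<in> {1..N}" for l
      using S_nz that by fastforce
    moreover have "\<forall>k. k \<notin> {1..N} \<longrightarrow> incr i mu k = 0"
      using mu i by (auto simp: U_def sig_def incr_def)
    ultimately have "incr i mu \<in> U" using int0 by (auto simp: interlacing_def)
    then show "incr i mu \<in> U - {a \<in> U. ?h a = 0}" using nz by simp
  next
    fix nu assume nu: "nu \<in> U - {a \<in> U. ?h a = 0}"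
    then have nz: "?h nu \<noteq> 0" by blast
    then have l: "lam (Suc l) \<le> nu l \<and> nu l \<le> lam l" if "l \<in> {1..N}" for l
      using S_nz that by fastforce
    have "nu (Suc i) \<noteq> nu i" if "i < N" using nz that by (auto simp: gap_below_def)
    moreover have "nu \<in> sig N" using nu Usig by auto
    ultimately have "decr i nu \<in> sig N"
      using i by (intro sig_decr) (force simp: sig_def)+
    moreover have "lam (Suc k) - 1 \<le> decr i nu k \<and> decr i nu k \<le> lam k" if "k \<in> {1..N}" for k
      using l[OF that] by (auto simp: decr_def)
    ultimately have "decr i nu \<in> U" by (simp add: U_def)
    then show "decr i nu \<in> U - {a \<in> U. ?g a = 0}" using nz by simp
  qed (auto simp: fin)
  have "(\<Sum>i\<in>{1..Suc N}. gap_below (Suc N) lam i * qW_P q (Suc N) (decr i lam) x) =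
     (\<Sum>i\<in>{1..Suc N}. \<Sum>mu\<in>U. gap_below (Suc N) lam i * S (decr i lam) mu * P mu)"
  proof (rule sum.cong[OF refl])
    fix i assume i: "i \<in> {1..Suc N}"
    show "gap_below (Suc N) lam i * qW_P q (Suc N) (decr i lam) x =
      (\<Sum>mu\<in>U. gap_below (Suc N) lam i * S (decr i lam) mu * P mu)"
    proof (cases "gap_below (Suc N) lam i = 0")
      case False
      then have "i < Suc N \<longrightarrow> lam (Suc i) \<noteq> lam i" by (auto simp: gap_below_def)
      then have "decr i lam \<in> sig (Suc N)"
        using i Suc.prems(1) by (intro sig_decr) (force simp: sig_def)+
      then show ?thesis using branch[OF _ int1] by (simp add: sum_distrib_left mult.assoc)
    qed simp
  qed
  also have "\<dots> = (\<Sum>mu\<in>U. (\<Sum>i\<in>{1..Suc N}. gap_below (Suc N) lam i * S (decr i lam) mu) * P mu)"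
    by (subst sum.swap) (simp only: sum_distrib_right)
  also have "\<dots> = (\<Sum>mu\<in>U. (inverse y * S lam mu +
     (\<Sum>i\<in>{1..N}. gap_below N (incr i mu) i * S lam (incr i mu))) * P mu)"
    unfolding S_def using skew_Pieri[OF Suc.prems(1) y] by simp
  also have "\<dots> = inverse y * qW_P q (Suc N) lam x +
     (\<Sum>mu\<in>U. (\<Sum>i\<in>{1..N}. gap_below N (incr i mu) i * S lam (incr i mu) * P mu))"
    unfolding branch[OF Suc.prems(1) int0]
    by (simp add: distrib_right sum.distrib sum_distrib_left sum_distrib_right mult.assoc)
  also have "(\<Sum>mu\<in>U. (\<Sum>i\<in>{1..N}. gap_below N (incr i mu) i * S lam (incr i mu) * P mu)) =
     (\<Sum>nu\<in>U. \<Sum>i\<in>{1..N}. gap_below N nu i * S lam nu * P (decr i nu))"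
    by (subst (1 2) sum.swap) (intro sum.cong refl shift)
  also have "\<dots> = (\<Sum>nu\<in>U. S lam nu * ((\<Sum>j\<in>{1..N}. inverse (x j)) * P nu))"
  proof (rule sum.cong[OF refl])
    fix nu assume "nu \<in> U"
    then have "(\<Sum>j\<in>{1..N}. inverse (x j)) * P nu = (\<Sum>i\<in>{1..N}. gap_below N nu i * P (decr i nu))"
      unfolding P_def using Usig Suc.prems(2) by (intro Suc.IH) auto
    then show "(\<Sum>i\<in>{1..N}. gap_below N nu i * S lam nu * P (decr i nu)) =
       S lam nu * ((\<Sum>j\<in>{1..N}. inverse (x j)) * P nu)"
      by (simp add: sum_distrib_left mult_ac)
  qed
  also have "\<dots> = (\<Sum>j\<in>{1..N}. inverse (x j)) * qW_P q (Suc N) lam x"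
    unfolding branch[OF Suc.prems(1) int0] by (subst sum_distrib_left) (simp only: mult_ac)
  finally show ?case by (simp add: y_def algebra_simps)
qed

end

subsection \<open>Time derivative of the torus integral\<close>

text \<open>As \<open>p\<close> is bounded by K, the second-order Taylor remainder of exp(p h) is at
  most e^K K^2 h^2 for |h| at most 1, uniformly on the space. Integrating this bound controls the
  error of the difference quotient directly.\<close>

lemma has_vector_derivative_integral_exp:
  fixes H p :: "'a \<Rightarrow> complex"
  assumes H: "integrable M H" and p: "p \<in> borel_measurable M"
    and K: "\<And>x. x \<in> space M \<Longrightarrow> norm (p x) \<le> K" "0 \<le> K"
  shows "((\<lambda>s. \<integral>x. H x * exp (p x * of_real s) \<partial>M) has_vector_derivative
           (\<integral>x. H x * p x * exp (p x * of_real t) \<partial>M)) (at t)"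
proof -
  have int_e: "integrable M (\<lambda>x. H x * exp (p x * of_real s))" for s :: real
  proof (rule Bochner_Integration.integrable_bound)
    show "integrable M (\<lambda>x. exp (K * \<bar>s\<bar>) * norm (H x))" using H by simp
    show "(\<lambda>x. H x * exp (p x * of_real s)) \<in> borel_measurable M" using H p by measurable
    show "AE x in M. norm (H x * exp (p x * of_real s)) \<le> norm (exp (K * \<bar>s\<bar>) * norm (H x))"
    proof (rule AE_I2)
      fix x assume "x \<in> space M"
      then have "norm (p x * of_real s) \<le> K * \<bar>s\<bar>"
        using K by (simp add: norm_mult mult_right_mono)
      then have "norm (exp (p x * of_real s)) \<le> exp (K * \<bar>s\<bar>)"
        by (meson exp_le_cancel_iff norm_exp order_trans)
      then show "norm (H x * exp (p x * of_real s)) \<le> norm (exp (K * \<bar>s\<bar>) * norm (H x))"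
        by (simp add: norm_mult mult.commute mult_left_mono del: norm_exp_eq_Re)
    qed
  qed
  have int_p: "integrable M (\<lambda>x. H x * p x * exp (p x * of_real s))" for s :: real
  proof (rule Bochner_Integration.integrable_bound)
    show "integrable M (\<lambda>x. K * norm (H x * exp (p x * of_real s)))" using int_e by simp
    show "(\<lambda>x. H x * p x * exp (p x * of_real s)) \<in> borel_measurable M" using H p by measurable
    show "AE x in M. norm (H x * p x * exp (p x * of_real s)) \<le> norm (K * norm (H x * exp (p x * of_real s)))"
    proof (rule AE_I2)
      fix x assume "x \<in> space M"
      then have "norm (p x) * norm (H x * exp (p x * of_real s)) \<le> K * norm (H x * exp (p x * of_real s))"
        using K by (intro mult_right_mono) auto
      then show "norm (H x * p x * exp (p x * of_real s)) \<le> norm (K * norm (H x * exp (p x * of_real s)))"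
        using K(2) by (simp add: norm_mult mult_ac)
    qed
  qed
  define f where "f = (\<lambda>s. \<integral>x. H x * exp (p x * of_real s) \<partial>M)"
  define D where "D = (\<integral>x. H x * p x * exp (p x * of_real t) \<partial>M)"
  define C where "C = (\<integral>x. norm (H x * exp (p x * of_real t)) \<partial>M) * (exp K * K\<^sup>2)"
  have bound: "norm (f (t + h) - f t - h *\<^sub>R D) \<le> C * h\<^sup>2" if h: "\<bar>h\<bar> \<le> 1" for h
  proof -
    let ?r = "\<lambda>x. H x * exp (p x * of_real t) * (exp (p x * of_real h) - (1 + p x * of_real h))"
    have eq: "H x * exp (p x * of_real (t + h)) - H x * exp (p x * of_real t)
        - of_real h * (H x * p x * exp (p x * of_real t)) = ?r x" for x
      by (simp add: distrib_left exp_add algebra_simps)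
    have int_r: "integrable M ?r"
      unfolding eq[symmetric]
      by (intro Bochner_Integration.integrable_diff integrable_mult_right int_e int_p)
    have "f (t + h) - f t - h *\<^sub>R D = (\<integral>x. ?r x \<partial>M)"
      unfolding eq[symmetric] f_def D_def scaleR_conv_of_real
      using int_e[of t] int_e[of "t + h"] int_p by simp
    also have "norm \<dots> \<le> (\<integral>x. norm (?r x) \<partial>M)"
      by (rule integral_norm_bound)
    also have "\<dots> \<le> (\<integral>x. norm (H x * exp (p x * of_real t)) * (exp K * K\<^sup>2 * h\<^sup>2) \<partial>M)"
    proof (rule integral_mono)
      show "integrable M (\<lambda>x. norm (?r x))" using int_r by simp
      show "integrable M (\<lambda>x. norm (H x * exp (p x * of_real t)) * (exp K * K\<^sup>2 * h\<^sup>2))"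
        using int_e by simp
      fix x assume x: "x \<in> space M"
      let ?w = "p x * of_real h"
      have w: "norm ?w \<le> K * \<bar>h\<bar>" using K x by (simp add: norm_mult mult_right_mono)
      have "K * \<bar>h\<bar> \<le> K * 1" using K(2) h by (intro mult_left_mono) auto
      with w have w': "norm ?w \<le> K" by simp
      have "norm (exp ?w - (1 + ?w)) \<le> exp (norm ?w) * norm ?w ^ 2"
        using Taylor_exp_field[of ?w 1] by (simp add: numeral_2_eq_2)
      also have "\<dots> \<le> exp K * (K * \<bar>h\<bar>) ^ 2"
        using w w' by (intro mult_mono power_mono) auto
      finally have "norm (exp ?w - (1 + ?w)) \<le> exp K * K\<^sup>2 * h\<^sup>2"
        by (simp add: power_mult_distrib mult_ac)
      then show "norm (?r x) \<le> norm (H x * exp (p x * of_real t)) * (exp K * K\<^sup>2 * h\<^sup>2)"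
        unfolding norm_mult[of "H x * exp (p x * of_real t)"] by (intro mult_left_mono) auto
    qed
    also have "\<dots> = C * h\<^sup>2" by (simp add: C_def)
    finally show ?thesis .
  qed
  have "((\<lambda>h. norm (f (t + h) - f t - h *\<^sub>R D) / norm h) \<longlongrightarrow> 0) (at 0)"
  proof (rule Lim_null_comparison)
    have "\<forall>\<^sub>F h in at 0. h \<in> ball (0::real) 1" using eventually_at_ball[of 1 "0::real" UNIV] by simp
    then show "\<forall>\<^sub>F h in at 0. norm (norm (f (t + h) - f t - h *\<^sub>R D) / norm h) \<le> C * \<bar>h\<bar>"
    proof eventually_elim
      case (elim h)
      then have "norm (f (t + h) - f t - h *\<^sub>R D) \<le> C * \<bar>h\<bar> * \<bar>h\<bar>"
        using bound[of h] by (simp add: power2_eq_square mult.assoc)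
      then show ?case by (cases "h = 0") (simp_all add: divide_le_eq)
    qed
    show "((\<lambda>h. C * \<bar>h\<bar>) \<longlongrightarrow> 0) (at (0::real))"
      by (auto intro!: tendsto_eq_intros)
  qed
  then have "(f has_vector_derivative D) (at t)"
    unfolding has_vector_derivative_def has_derivative_at
    by (simp add: bounded_linear_scaleR_left)
  then show ?thesis by (simp add: f_def D_def)
qed

section \<open>Bounded measurable functions on the torus\<close>

definition torus :: "nat \<Rightarrow> (nat \<Rightarrow> real) measure" where
  "torus N = PiM {1..N} (\<lambda>_. restrict_space lborel {0..2*pi})"

lemma finite_measure_torus: "finite_measure (torus N)"
proof
  interpret R: finite_measure "restrict_space lborel {0..2*pi}"
    by standard (simp add: emeasure_restrict_space space_restrict_space)
  interpret product_sigma_finite "\<lambda>_::nat. restrict_space lborel {0..2*pi}" 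
    by standard
  let ?R = "restrict_space lborel {0..2*pi}"
  have "emeasure (torus N) (space (torus N)) = (\<Prod>i\<in>{1..N}. emeasure ?R (space ?R))"
    unfolding torus_def space_PiM by (rule emeasure_PiM) (simp, rule sets.top)
  then show "emeasure (torus N) (space (torus N)) \<noteq> \<infinity>"
    by (simp add: power_eq_top_ennreal)
qed

text \<open>Unlike integrability, this property passes to products, and on the finite measure
  \<open>torus N\<close> it implies integrability.\<close>

definition bdd_meas :: "'a measure \<Rightarrow> ('a \<Rightarrow> complex) \<Rightarrow> bool" where
  "bdd_meas M f \<longleftrightarrow> f \<in> borel_measurable M \<and> (\<exists>B. \<forall>x\<in>space M. norm (f x) \<le> B)"

lemma bdd_measI: "f \<in> borel_measurable M \<Longrightarrow> (\<And>x. x \<in> space M \<Longrightarrow> norm (f x) \<le> B) \<Longrightarrow> bdd_meas M f"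
  by (auto simp: bdd_meas_def)

lemma bdd_meas_const: "bdd_meas M (\<lambda>_. c)"
  by (rule bdd_measI[where B="norm c"]) auto

lemma bdd_meas_mult:
  assumes "bdd_meas M f" "bdd_meas M g" shows "bdd_meas M (\<lambda>x. f x * g x)"
proof -
  obtain A B where "\<forall>x\<in>space M. norm (f x) \<le> A" "\<forall>x\<in>space M. norm (g x) \<le> B"
    using assms by (auto simp: bdd_meas_def)
  then have "norm (f x * g x) \<le> \<bar>A\<bar> * \<bar>B\<bar>" if "x \<in> space M" for x
    unfolding norm_mult using that by (intro mult_mono) force+
  then show ?thesis using assms by (intro bdd_measI) (auto simp: bdd_meas_def)
qed

lemma bdd_meas_add:
  assumes "bdd_meas M f" "bdd_meas M g" shows "bdd_meas M (\<lambda>x. f x + g x)"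
proof -
  obtain A B where "\<forall>x\<in>space M. norm (f x) \<le> A" "\<forall>x\<in>space M. norm (g x) \<le> B"
    using assms by (auto simp: bdd_meas_def)
  then have "norm (f x + g x) \<le> A + B" if "x \<in> space M" for x
    using that by (intro norm_triangle_le add_mono) auto
  then show ?thesis using assms by (intro bdd_measI) (auto simp: bdd_meas_def)
qed

lemma bdd_meas_prod:
  "(\<And>i. i \<in> I \<Longrightarrow> bdd_meas M (f i)) \<Longrightarrow> bdd_meas M (\<lambda>x. \<Prod>i\<in>I. f i x)"
  by (induction I rule: infinite_finite_induct) (auto simp: bdd_meas_const intro!: bdd_meas_mult)

lemma bdd_meas_sum:
  "(\<And>i. i \<in> I \<Longrightarrow> bdd_meas M (f i)) \<Longrightarrow> bdd_meas M (\<lambda>x. \<Sum>i\<in>I. f i x)"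
  by (induction I rule: infinite_finite_induct) (auto simp: bdd_meas_const intro!: bdd_meas_add)

lemma integrable_bdd_meas: "bdd_meas (torus N) f \<Longrightarrow> integrable (torus N) f"
  unfolding bdd_meas_def
  by (blast intro: finite_measure.integrable_const_bound[OF finite_measure_torus] AE_I2)

lemma measurable_torus_component [measurable]:
  assumes "j \<in> {1..N}" shows "(\<lambda>\<theta>. \<theta> j) \<in> borel_measurable (torus N)"
proof -
  have "(\<lambda>x. x) \<in> restrict_space lborel {0..2*pi} \<rightarrow>\<^sub>M borel"
    by (rule measurable_restrict_space1) simp
  from measurable_compose[OF measurable_component_singleton[OF assms] this]
  show ?thesis by (simp add: torus_def)
qed

lemma measurable_cis: "cis \<in> borel_measurable borel"
  by (intro borel_measurable_continuous_onI continuous_on_cis continuous_on_id)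

lemma bdd_meas_cis: "j \<in> {1..N} \<Longrightarrow> bdd_meas (torus N) (\<lambda>\<theta>. cis (\<theta> j))"
  by (rule bdd_measI[where B=1])
     (auto intro!: measurable_compose[OF measurable_torus_component measurable_cis])

text \<open>Continuity on a compact disc gives the bound, while measurability is required globally.
  The separation serves the reciprocal of \<open>qpinf q\<close>, which is controlled only inside
  the unit disc.\<close>

lemma bdd_meas_compose:
  fixes f :: "'a \<Rightarrow> complex" and \<phi> :: "complex \<Rightarrow> complex"
  assumes f: "f \<in> borel_measurable M" and le: "\<And>x. x \<in> space M \<Longrightarrow> norm (f x) \<le> r"
    and c: "continuous_on (cball 0 r) \<phi>" and m: "\<phi> \<in> borel_measurable borel"
  shows "bdd_meas M (\<lambda>x. \<phi> (f x))"
proof -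
  have "bounded (\<phi> ` cball 0 r)"
    using c by (intro compact_imp_bounded compact_continuous_image) auto
  then obtain B where B: "\<And>z. z \<in> cball 0 r \<Longrightarrow> norm (\<phi> z) \<le> B"
    unfolding bounded_iff by blast
  show ?thesis
    by (rule bdd_measI[where B=B]) (use measurable_compose[OF f m] B le in auto)
qed

context q_param
begin

lemma measurable_qpinf: "qpinf q \<in> borel_measurable borel"
  by (intro borel_measurable_continuous_onI continuous_on_qpinf)

lemma bdd_meas_qW_P: "bdd_meas (torus N) (\<lambda>\<theta>. qW_P q N lam (\<lambda>j. 1 / cis (\<theta> j)))"
  unfolding qW_P_def
proof (intro bdd_meas_sum bdd_meas_prod)
  fix g :: "nat \<Rightarrow> nat \<Rightarrow> int" and j assume j: "j \<in> {1..N}"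
  have "bdd_meas (torus N) (\<lambda>\<theta>. (1 / cis (\<theta> j)) powi n)" for n
  proof (rule bdd_measI[where B=1])
    have [measurable]: "(\<lambda>\<theta>. cis (\<theta> j)) \<in> borel_measurable (torus N)"
      using bdd_meas_cis[OF j] by (simp add: bdd_meas_def)
    show "(\<lambda>\<theta>. (1 / cis (\<theta> j)) powi n) \<in> borel_measurable (torus N)"
      by (cases "n \<ge> 0") (simp_all add: power_int_def)
    show "norm ((1 / cis (\<theta> j)) powi n) \<le> 1" for \<theta> by (simp add: norm_power_int norm_divide)
  qed
  then show "bdd_meas (torus N) (\<lambda>\<theta>. Pskew q j (g j) (g (j-1)) (1 / cis (\<theta> j)))"
    unfolding Pskew_def by (intro bdd_meas_mult bdd_meas_const)
qed

lemma bdd_meas_mq: "bdd_meas (torus N) (\<lambda>\<theta>. mq q N (\<lambda>j. cis (\<theta> j)))"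
  unfolding mq_def
proof (intro bdd_meas_mult bdd_meas_const bdd_meas_prod)
  fix ij :: "nat \<times> nat" assume ij: "ij \<in> {(i, j). 1 \<le> i \<and> i < j \<and> j \<le> N}"
  have *: "bdd_meas (torus N) (\<lambda>\<theta>. qpinf q (cis (\<theta> i) / cis (\<theta> j)))"
    if "i \<in> {1..N}" "j \<in> {1..N}" for i j
  proof (rule bdd_meas_compose[where \<phi> = "qpinf q" and r=1])
    show "(\<lambda>\<theta>. cis (\<theta> i) / cis (\<theta> j)) \<in> borel_measurable (torus N)"
      using bdd_meas_cis[OF that(1)] bdd_meas_cis[OF that(2)]
      by (auto simp: bdd_meas_def intro!: borel_measurable_divide)
  qed (auto simp: norm_divide measurable_qpinf intro: continuous_on_subset[OF continuous_on_qpinf])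
  show "bdd_meas (torus N) (\<lambda>\<theta>. case ij of (i, j) \<Rightarrow>
      qpinf q (cis (\<theta> i) / cis (\<theta> j)) * qpinf q (cis (\<theta> j) / cis (\<theta> i)))"
    using ij by (cases ij) (auto intro!: bdd_meas_mult *)
qed

definition cauchy_factor :: "nat \<Rightarrow> nat \<Rightarrow> (nat \<Rightarrow> real) \<Rightarrow> (nat \<Rightarrow> complex) \<Rightarrow> complex" where
  "cauchy_factor N M alpha z = (\<Prod>i\<in>{1..M}. \<Prod>j\<in>{1..N}. inverse (qpinf q (complex_of_real (alpha i) / z j)))"

lemma Pi_fn_eq:
  "Pi_fn q N M alpha t z = cauchy_factor N M alpha z * exp ((\<Sum>j\<in>{1..N}. z j) * complex_of_real t)"
  by (simp add: Pi_fn_def cauchy_factor_def exp_sum sum_distrib_right)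

text \<open>On the torus |alpha_i / z_j| = |alpha_i| < 1, so the argument stays away from the zeros
  of \<open>qpinf q\<close>. The bound is asked only for N > 0, because for N = 0 there is no a_j to
  compare alpha_i with.\<close>

lemma bdd_meas_cauchy_factor:
  assumes "\<And>i. i \<in> {1..M} \<Longrightarrow> N > 0 \<Longrightarrow> \<bar>alpha i\<bar> < 1"
  shows "bdd_meas (torus N) (\<lambda>\<theta>. cauchy_factor N M alpha (\<lambda>j. cis (\<theta> j)))"
  unfolding cauchy_factor_def
proof (intro bdd_meas_prod)
  fix i j assume i: "i \<in> {1..M}" and j: "j \<in> {1..N}"
  then have a: "\<bar>alpha i\<bar> < 1" using assms[OF i] by auto
  show "bdd_meas (torus N) (\<lambda>\<theta>. inverse (qpinf q (complex_of_real (alpha i) / cis (\<theta> j))))"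
  proof (rule bdd_meas_compose[where \<phi> = "\<lambda>z. inverse (qpinf q z)" and r="\<bar>alpha i\<bar>"])
    show "(\<lambda>\<theta>. complex_of_real (alpha i) / cis (\<theta> j)) \<in> borel_measurable (torus N)"
      using bdd_meas_cis[OF j] by (auto simp: bdd_meas_def intro!: borel_measurable_divide)
    show "continuous_on (cball 0 \<bar>alpha i\<bar>) (\<lambda>z. inverse (qpinf q z))"
      using a by (intro continuous_on_inverse continuous_on_subset[OF continuous_on_qpinf])
        (auto intro!: qpinf_nz)
    show "(\<lambda>z. inverse (qpinf q z)) \<in> borel_measurable borel"
      by (intro borel_measurable_inverse measurable_qpinf)
  qed (auto simp: norm_divide)
qed

section \<open>The normalisation of Q and its time derivative\<close>

abbreviation Qnorm :: "nat \<Rightarrow> (nat \<Rightarrow> int) \<Rightarrow> complex" where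
  "Qnorm N lam \<equiv> \<Prod>i\<in>{1..N-1}. qpinf q (qc powi (lam i - lam (Suc i) + 1))"

text \<open>The factor of the gap below i absorbs 1 - q^(lam_i - lam_(i+1)), and the factor of the
  gap above i releases 1 - q^(lam_(i-1) - lam_i + 1). This converts Pieri coefficients into those of
  the evolution of Q. \<open>qpinf_powi_rec\<close> holds for all integers, so no ordering of
  \<open>lam\<close> enters.\<close>

lemma Qnorm_decr:
  assumes "i \<in> {1..N}"
  shows "gap_below N lam i * Qnorm N lam = gap_above lam lam i * Qnorm N (decr i lam)"
proof (rule prod_shift_window[where i=i])
  assume i: "i \<in> {1..N - 1}"
  then show "gap_below N lam i * qpinf q (qc powi (lam i - lam (Suc i) + 1)) =
    qpinf q (qc powi (decr i lam i - decr i lam (Suc i) + 1))"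
    using qpinf_powi_rec[of "lam i - lam (Suc i)"] by (auto simp: gap_below_def decr_def)
next
  assume i: "i - 1 \<in> {1..N - 1}"
  then have *: "Suc (i - Suc 0) = i" by auto
  have "lam (i - 1) - (lam i - 1) + 1 = lam (i - 1) - lam i + 1 + 1" by simp
  then show "qpinf q (qc powi (lam (i - 1) - lam (Suc (i - 1)) + 1)) =
    gap_above lam lam i * qpinf q (qc powi (decr i lam (i - 1) - decr i lam (Suc (i - 1)) + 1))"
    using i qpinf_powi_rec[of "lam (i - 1) - lam i + 1"]
    by (auto simp: gap_above_def decr_def *)
qed (use assms in \<open>auto simp: decr_def gap_below_def gap_above_def\<close>)

text \<open>The prefactor contains (q^0; q)_infinity = 0. An illegal lowering of the top row thus
  drops out of the evolution of Q, as it does from the inflow.\<close>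

lemma Q_fn_decr_eq_0:
  assumes "i \<in> {1..<N}" "lam (Suc i) = lam i"
  shows "Q_fn q N M alpha t (decr i lam) = 0"
proof -
  have "Qnorm N (decr i lam) = 0"
    using assms by (auto simp: decr_def intro!: prod_zero bexI[of _ i])
  then show ?thesis by (simp add: Q_fn_def)
qed

lemma Q_fn_derivative:
  assumes lam: "lam \<in> sig N" and alpha: "\<And>i. i \<in> {1..M} \<Longrightarrow> N > 0 \<Longrightarrow> \<bar>alpha i\<bar> < 1"
  shows "((\<lambda>s. Q_fn q N M alpha s lam) has_vector_derivative
     (\<Sum>i\<in>{1..N}. gap_above lam lam i * Q_fn q N M alpha t (decr i lam))) (at t)"
proof -
  define W where "W = (\<lambda>lam \<theta>. qW_P q N lam (\<lambda>j. 1 / cis (\<theta> j)))"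
  define p where "p = (\<lambda>\<theta>::nat \<Rightarrow> real. \<Sum>j\<in>{1..N}. cis (\<theta> j))"
  define K where "K = (\<lambda>\<theta>. cauchy_factor N M alpha (\<lambda>j. cis (\<theta> j)) * mq q N (\<lambda>j. cis (\<theta> j)))"
  have K: "bdd_meas (torus N) K"
    unfolding K_def by (intro bdd_meas_mult bdd_meas_cauchy_factor bdd_meas_mq alpha)
  have W: "bdd_meas (torus N) (W nu)" for nu
    unfolding W_def by (rule bdd_meas_qW_P)
  have p: "bdd_meas (torus N) p" unfolding p_def by (intro bdd_meas_sum bdd_meas_cis)
  have p_le: "norm (p \<theta>) \<le> real N" for \<theta>
    unfolding p_def by (rule order_trans[OF norm_sum]) simp
  have ex: "bdd_meas (torus N) (\<lambda>\<theta>. exp (p \<theta> * of_real s))" for s :: real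
  proof (rule bdd_meas_compose[where \<phi>="\<lambda>z. exp (z * of_real s)" and r="real N"])
    show "(\<lambda>z. exp (z * complex_of_real s)) \<in> borel_measurable borel"
      by (intro borel_measurable_continuous_onI continuous_intros)
  qed (use p p_le in \<open>auto simp: bdd_meas_def intro!: continuous_intros\<close>)
  have Q_eq: "Q_fn q N M alpha s nu = Qnorm N nu * (\<i> ^ N * (\<integral>\<theta>. W nu \<theta> * K \<theta> * exp (p \<theta> * of_real s) \<partial>torus N))" for s nu
    unfolding Q_fn_def torus_int_def torus_def[symmetric] Pi_fn_eq W_def K_def p_def by (simp only: mult_ac)
  \<comment> \<open>At x_j = 1 / z_j the sum of the inverses is \<open>p\<close>, the factor
    produced by differentiating the exponential.\<close>
  have pieri: "p \<theta> * W lam \<theta> = (\<Sum>i\<in>{1..N}. gap_below N lam i * W (decr i lam) \<theta>)" for \<theta>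
    using qW_P_Pieri[OF lam, of "\<lambda>j. 1 / cis (\<theta> j)"] by (simp add: p_def W_def)
  have "((\<lambda>s. \<integral>\<theta>. W lam \<theta> * K \<theta> * exp (p \<theta> * of_real s) \<partial>torus N) has_vector_derivative
           (\<integral>\<theta>. W lam \<theta> * K \<theta> * p \<theta> * exp (p \<theta> * of_real t) \<partial>torus N)) (at t)"
    using K W p p_le
    by (intro has_vector_derivative_integral_exp[where K="real N"])
       (auto intro!: integrable_bdd_meas bdd_meas_mult simp: bdd_meas_def[of _ p])
  then have "((\<lambda>s. (Qnorm N lam * \<i> ^ N) * (\<integral>\<theta>. W lam \<theta> * K \<theta> * exp (p \<theta> * of_real s) \<partial>torus N)) has_vector_derivative
     (Qnorm N lam * \<i> ^ N) * (\<integral>\<theta>. W lam \<theta> * K \<theta> * p \<theta> * exp (p \<theta> * of_real t) \<partial>torus N)) (at t)"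
    by (rule has_vector_derivative_mult_right)
  moreover have "(Qnorm N lam * \<i> ^ N) * (\<integral>\<theta>. W lam \<theta> * K \<theta> * p \<theta> * exp (p \<theta> * of_real t) \<partial>torus N) =
     (\<Sum>i\<in>{1..N}. gap_above lam lam i * Q_fn q N M alpha t (decr i lam))"
  proof -
    have "(\<integral>\<theta>. W lam \<theta> * K \<theta> * p \<theta> * exp (p \<theta> * of_real t) \<partial>torus N) =
       (\<integral>\<theta>. (\<Sum>i\<in>{1..N}. gap_below N lam i * (W (decr i lam) \<theta> * K \<theta> * exp (p \<theta> * of_real t))) \<partial>torus N)"
    proof (rule Bochner_Integration.integral_cong[OF refl])
      fix \<theta>
      have "W lam \<theta> * K \<theta> * p \<theta> * exp (p \<theta> * of_real t) = (p \<theta> * W lam \<theta>) * (K \<theta> * exp (p \<theta> * of_real t))"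
        by (simp only: mult_ac)
      then show "W lam \<theta> * K \<theta> * p \<theta> * exp (p \<theta> * of_real t) =
        (\<Sum>i\<in>{1..N}. gap_below N lam i * (W (decr i lam) \<theta> * K \<theta> * exp (p \<theta> * of_real t)))"
        unfolding pieri sum_distrib_right by (simp only: mult_ac)
    qed
    also have "\<dots> = (\<Sum>i\<in>{1..N}. gap_below N lam i * (\<integral>\<theta>. W (decr i lam) \<theta> * K \<theta> * exp (p \<theta> * of_real t) \<partial>torus N))"
      by (subst Bochner_Integration.integral_sum) (auto intro!: integrable_bdd_meas bdd_meas_mult K W ex bdd_meas_const)
    also have "(Qnorm N lam * \<i> ^ N) * \<dots> = (\<Sum>i\<in>{1..N}. (gap_below N lam i * Qnorm N lam) *
        (\<i> ^ N * (\<integral>\<theta>. W (decr i lam) \<theta> * K \<theta> * exp (p \<theta> * of_real t) \<partial>torus N)))"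
      unfolding sum_distrib_left by (simp only: mult_ac)
    also have "\<dots> = (\<Sum>i\<in>{1..N}. gap_above lam lam i * Q_fn q N M alpha t (decr i lam))"
      unfolding Q_eq by (intro sum.cong refl) (simp only: Qnorm_decr mult.assoc)
    finally show ?thesis .
  qed
  ultimately show ?thesis unfolding Q_eq by (simp add: mult.assoc)
qed

end

subsection \<open>Jumps of patterns and their preimages\<close>

lemma gt_outside: "g \<in> gt N \<Longrightarrow> \<not> (1 \<le> i \<and> i \<le> n \<and> n \<le> N) \<Longrightarrow> g n i = 0"
  by (auto simp: gt_def)

lemma gt_row: "g \<in> gt N \<Longrightarrow> 1 \<le> i \<Longrightarrow> i < n \<Longrightarrow> n \<le> N \<Longrightarrow> g n (Suc i) \<le> g n i"
  by (auto simp: gt_def)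

lemma gt_upper: "g \<in> gt N \<Longrightarrow> 1 \<le> i \<Longrightarrow> i \<le> n \<Longrightarrow> n < N \<Longrightarrow> g n i \<le> g (Suc n) i"
  by (auto simp: gt_def)

lemma gt_lower: "g \<in> gt N \<Longrightarrow> 1 \<le> i \<Longrightarrow> i \<le> n \<Longrightarrow> n < N \<Longrightarrow> g (Suc n) (Suc i) \<le> g n i"
  by (auto simp: gt_def)

lemma gt_lower': "g \<in> gt N \<Longrightarrow> 1 < i \<Longrightarrow> i \<le> n \<Longrightarrow> n \<le> N \<Longrightarrow> g n i \<le> g (n - 1) (i - 1)"
  using gt_lower[of g N "i - 1" "n - 1"] by simp

lemma gt_upper': "g \<in> gt N \<Longrightarrow> 1 \<le> i \<Longrightarrow> i < n \<Longrightarrow> n \<le> N \<Longrightarrow> g (n - 1) i \<le> g n i"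
  using gt_upper[of g N i "n - 1"] by simp

lemma gtI:
  assumes "\<And>n i. \<not> (1 \<le> i \<and> i \<le> n \<and> n \<le> N) \<Longrightarrow> g n i = 0"
    and "\<And>n i. 1 \<le> i \<Longrightarrow> i < n \<Longrightarrow> n \<le> N \<Longrightarrow> g n (Suc i) \<le> g n i"
    and "\<And>n i. 1 \<le> i \<Longrightarrow> i \<le> n \<Longrightarrow> n < N \<Longrightarrow> g n i \<le> g (Suc n) i"
    and "\<And>n i. 1 \<le> i \<Longrightarrow> i \<le> n \<Longrightarrow> n < N \<Longrightarrow> g (Suc n) (Suc i) \<le> g n i"
  shows "g \<in> gt N"
  using assms by (auto simp: gt_def)

lemma gt_column_mono:
  assumes "g \<in> gt N" "1 \<le> j" "j \<le> m" "m \<le> n" "n \<le> N"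
  shows "g m j \<le> g n j"
  using assms(4,5)
proof (induction n rule: dec_induct)
  case (step n)
  then show ?case using gt_upper[OF assms(1,2), of n] assms(3) by auto
qed simp

lemma mjk_spec:
  assumes "k \<le> N"
  shows "k + mjk N mu j k \<le> N" "\<And>b. b \<in> {k..k + mjk N mu j k} \<Longrightarrow> mu b j = mu k j"
    "k + mjk N mu j k < N \<Longrightarrow> mu (Suc (k + mjk N mu j k)) j \<noteq> mu k j"
proof -
  let ?P = "\<lambda>m. k + m \<le> N \<and> (\<forall>b\<in>{k..k+m}. mu b j = mu k j)"
  have P: "?P (mjk N mu j k)"
    unfolding mjk_def by (rule GreatestI_nat[of ?P 0 N]) (use assms in simp, elim conjE, linarith)
  then show "k + mjk N mu j k \<le> N" "\<And>b. b \<in> {k..k + mjk N mu j k} \<Longrightarrow> mu b j = mu k j"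
    by blast+
  have max: "m \<le> mjk N mu j k" if "?P m" for m
    unfolding mjk_def by (rule Greatest_le_nat[of ?P m N, OF that]) (elim conjE, linarith)
  show "mu (Suc (k + mjk N mu j k)) j \<noteq> mu k j" if "k + mjk N mu j k < N"
  proof
    assume *: "mu (Suc (k + mjk N mu j k)) j = mu k j"
    have "mu b j = mu k j" if "b \<in> {k..k + Suc (mjk N mu j k)}" for b
    proof (cases "b = Suc (k + mjk N mu j k)")
      case False
      then have "b \<in> {k..k + mjk N mu j k}" using that by simp
      then show ?thesis using P by blast
    qed (simp only: *)
    moreover have "k + Suc (mjk N mu j k) \<le> N" using that by linarith
    ultimately have "?P (Suc (mjk N mu j k))" by blast
    from max[OF this] show False by simp
  qed
qed

text \<open>The condition \<open>free\<close> says that the first factor of the rate does not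
  vanish. Column j - 1 grows with the row index while column j is constant on the run, so strictness
  at row k persists along the whole run.\<close>

lemma gt_plus_in_gt:
  assumes mu: "mu \<in> gt N" and k: "1 \<le> j" "j \<le> k" "k \<le> N"
    and free: "j = 1 \<or> mu k j < mu (k - 1) (j - 1)"
  shows "gt_plus N mu j k \<in> gt N"
proof -
  let ?e = "k + mjk N mu j k"
  note m = mjk_spec[OF k(3), where mu=mu and j=j]
  have left: "mu n j < mu (n - 1) (j - 1)" if "k \<le> n" "n \<le> ?e" "j \<noteq> 1" for n
  proof -
    have "mu (k - 1) (j - 1) \<le> mu (n - 1) (j - 1)"
      using that k m(1) by (intro gt_column_mono[OF mu]) auto
    then show ?thesis using free that m(2)[of n] by auto
  qed
  have left': "mu n j < mu n (j - 1)" if "k \<le> n" "n \<le> ?e" "j \<noteq> 1" for n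
  proof -
    have "mu (n - 1) (j - 1) \<le> mu (Suc (n - 1)) (j - 1)"
      using that k m(1) by (intro gt_upper[OF mu]) auto
    moreover have "Suc (n - 1) = n" using that k by simp
    ultimately show ?thesis using left[OF that] by simp
  qed
  \<comment> \<open>Maximality of the run leaves room for one unit below row
    \<open>Suc ?e\<close>.\<close>
  have right: "mu ?e j < mu (Suc ?e) j" if "?e < N"
    using m(3)[OF that] gt_upper[OF mu k(1) _ that] m(2)[of ?e] k by auto
  show ?thesis
  proof (rule gtI)
    fix n i assume "\<not> (1 \<le> i \<and> i \<le> n \<and> n \<le> N)"
    then show "gt_plus N mu j k n i = 0"
      using gt_outside[OF mu, of i n] k m(1) by (auto simp: gt_plus_def)
  next
    fix n i assume *: "1 \<le> i" "i < n" "n \<le> N"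
    then show "gt_plus N mu j k n (Suc i) \<le> gt_plus N mu j k n i"
      using gt_row[OF mu *] left'[of n] by (auto simp: gt_plus_def)
  next
    fix n i assume *: "1 \<le> i" "i \<le> n" "n < N"
    then show "gt_plus N mu j k n i \<le> gt_plus N mu j k (Suc n) i"
      using gt_upper[OF mu *] right by (cases "n = ?e") (auto simp: gt_plus_def)
    show "gt_plus N mu j k (Suc n) (Suc i) \<le> gt_plus N mu j k n i"
      using gt_lower[OF mu *] left[of "Suc n"] * by (auto simp: gt_plus_def)
  qed
qed

text \<open>The preimages of \<open>lam\<close> under the jump started at \<open>(j, k)\<close>: the length of the pushed run is
  not determined by \<open>lam\<close>, so there is one candidate for each last row \<open>e\<close>.\<close>
definition run_lowered :: "(nat \<Rightarrow> nat \<Rightarrow> int) \<Rightarrow> nat \<Rightarrow> nat \<Rightarrow> nat \<Rightarrow> nat \<Rightarrow> nat \<Rightarrow> int" where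
  "run_lowered lam j k e = (\<lambda>n i. if i = j \<and> k \<le> n \<and> n \<le> e then lam n i - 1 else lam n i)"

definition valid_run :: "nat \<Rightarrow> (nat \<Rightarrow> nat \<Rightarrow> int) \<Rightarrow> nat \<Rightarrow> nat \<Rightarrow> nat \<Rightarrow> bool" where
  "valid_run N lam j k e \<longleftrightarrow> (\<forall>b\<in>{k..e}. lam b j = lam k j) \<and> run_lowered lam j k e \<in> gt N"

lemma valid_run_gt: "valid_run N lam j k e \<Longrightarrow> run_lowered lam j k e \<in> gt N"
  by (simp add: valid_run_def)

lemma valid_run_const: "valid_run N lam j k e \<Longrightarrow> b \<in> {k..e} \<Longrightarrow> lam b j = lam k j"
  unfolding valid_run_def by blast

lemma run_lowered_row:
  "run_lowered lam j k e n = (if k \<le> n \<and> n \<le> e then decr j (lam n) else lam n)"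
  by (auto simp: run_lowered_def decr_def fun_eq_iff)

text \<open>Lowering the run separates it from row e + 1, whose entry in column j is at least
  \<open>lam e j\<close>. The maximal constant run of the lowered pattern from row k therefore ends
  exactly at e, so e is recovered from \<open>mjk\<close>.\<close>

lemma gt_plus_preimage:
  assumes lam: "lam \<in> gt N" and k: "1 \<le> j" "j \<le> k" "k \<le> N"
  shows "bij_betw (run_lowered lam j k) {e \<in> {k..N}. valid_run N lam j k e}
     {mu \<in> gt N. gt_plus N mu j k = lam}"
proof (rule bij_betw_byWitness[where f' = "\<lambda>mu. k + mjk N mu j k"])
  have mjk: "k + mjk N (run_lowered lam j k e) j k = e" if e: "e \<in> {k..N}" "valid_run N lam j k e" for e
  proof -
    let ?mu = "run_lowered lam j k e"
    note m = mjk_spec[OF k(3), where mu="?mu" and j=j]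
    have c: "lam b j = lam k j" if "b \<in> {k..e}" for b using valid_run_const e(2) that .
    have mk: "?mu k j = lam k j - 1" using e by (simp add: run_lowered_def)
    show ?thesis
    proof (rule linorder_cases[of "k + mjk N ?mu j k" e])
      assume less: "k + mjk N ?mu j k < e"
      then have "?mu (Suc (k + mjk N ?mu j k)) j = lam k j - 1"
        using c[of "Suc (k + mjk N ?mu j k)"] by (simp add: run_lowered_def)
      then show ?thesis using m(3) less e mk by auto
    next
      assume gr: "e < k + mjk N ?mu j k"
      then have "?mu (Suc e) j = lam k j - 1" using m(2)[of "Suc e"] e mk by auto
      moreover have "lam e j \<le> lam (Suc e) j" using gr m(1) k e by (intro gt_upper[OF lam]) auto
      ultimately show ?thesis using c[of e] e by (auto simp: run_lowered_def)
    qed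
  qed
  show "\<forall>e\<in>{e \<in> {k..N}. valid_run N lam j k e}. k + mjk N (run_lowered lam j k e) j k = e"
    using mjk by blast
  have plus: "gt_plus N (run_lowered lam j k e) j k = lam" if "e \<in> {k..N}" "valid_run N lam j k e" for e
    unfolding gt_plus_def mjk[OF that] by (auto simp: run_lowered_def fun_eq_iff)
  show "run_lowered lam j k ` {e \<in> {k..N}. valid_run N lam j k e} \<subseteq> {mu \<in> gt N. gt_plus N mu j k = lam}"
    using plus valid_run_gt by blast
  have inv: "run_lowered (gt_plus N mu j k) j k (k + mjk N mu j k) = mu" for mu
    by (auto simp: run_lowered_def gt_plus_def fun_eq_iff)
  show "\<forall>mu\<in>{mu \<in> gt N. gt_plus N mu j k = lam}. run_lowered lam j k (k + mjk N mu j k) = mu"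
    using inv by auto
  show "(\<lambda>mu. k + mjk N mu j k) ` {mu \<in> gt N. gt_plus N mu j k = lam} \<subseteq> {e \<in> {k..N}. valid_run N lam j k e}"
  proof (clarify)
    fix mu assume mu: "mu \<in> gt N" "lam = gt_plus N mu j k"
    note m = mjk_spec[OF k(3), where mu=mu and j=j]
    show "k + mjk N mu j k \<in> {k..N} \<and> valid_run N (gt_plus N mu j k) j k (k + mjk N mu j k)"
    proof
      show "k + mjk N mu j k \<in> {k..N}" using m(1) by simp
      have "gt_plus N mu j k b j = gt_plus N mu j k k j" if "b \<in> {k..k + mjk N mu j k}" for b
        using m(2)[OF that] that by (simp add: gt_plus_def)
      then show "valid_run N (gt_plus N mu j k) j k (k + mjk N mu j k)"
        unfolding valid_run_def inv using mu(1) by blast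
    qed
  qed
qed

section \<open>Uniqueness and existence of a run with a given last row\<close>

lemma valid_run_start:
  assumes "lam \<in> gt N" "1 \<le> j" "j < k" "k \<le> e" "e \<le> N" "valid_run N lam j k e"
  shows "lam (k - 1) j < lam k j"
  using gt_upper[OF valid_run_gt[OF assms(6)], of j "k - 1"] assms(2-5)
  by (cases k) (auto simp: run_lowered_def)

text \<open>A later start b would lie inside the constant run of an earlier start, whereas
  \<open>valid_run_start\<close> demands a strict increase from row b - 1 to row b.\<close>

lemma valid_run_unique:
  assumes "lam \<in> gt N" "1 \<le> j" "j \<le> k" "k \<le> e" "j \<le> k'" "k' \<le> e" "e \<le> N"
    and "valid_run N lam j k e" "valid_run N lam j k' e"
  shows "k = k'"
proof -
  have False if "1 \<le> j" "j \<le> a" "a < b" "b \<le> e" "valid_run N lam j a e" "valid_run N lam j b e" for a b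
  proof -
    have "b - 1 \<in> {a..e}" "b \<in> {a..e}" using that by auto
    then have "lam (b - 1) j = lam a j" "lam b j = lam a j"
      using that(5) unfolding valid_run_def by blast+
    then show False using valid_run_start[OF assms(1), of j b e] that assms(7) by auto
  qed
  from this[of k k'] this[of k' k] show ?thesis using assms by (cases rule: linorder_cases) auto
qed

text \<open>This is the obstruction at the last row of a run. When it fails, the inflow coefficient
  vanishes too: through \<open>blocked_rate\<close> for e < N, and through
  \<open>Q_fn_decr_eq_0\<close> for e = N.\<close>

definition removable :: "nat \<Rightarrow> (nat \<Rightarrow> nat \<Rightarrow> int) \<Rightarrow> nat \<Rightarrow> nat \<Rightarrow> bool" where
  "removable N lam j e \<longleftrightarrow>
     (if e < N then lam (Suc e) (Suc j) < lam e j else j < N \<longrightarrow> lam N (Suc j) < lam N j)"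

lemma valid_run_removable:
  assumes "1 \<le> j" "j \<le> k" "k \<le> e" "e \<le> N" "valid_run N lam j k e"
  shows "removable N lam j e"
proof (cases "e < N")
  case True
  then show ?thesis using gt_lower[OF valid_run_gt[OF assms(5)], of j e] assms(1-4)
    by (auto simp: run_lowered_def removable_def)
next
  case False
  then have "e = N" using assms by simp
  then show ?thesis using gt_row[OF valid_run_gt[OF assms(5)], of j N] assms(1-4)
    by (auto simp: run_lowered_def removable_def)
qed

text \<open>The run starts at the first row where column j attains its value at row e.\<close>

lemma valid_run_exists:
  assumes lam: "lam \<in> gt N" and j: "1 \<le> j" "j \<le> e" "e \<le> N" and rem: "removable N lam j e"
  obtains k where "j \<le> k" "k \<le> e" "valid_run N lam j k e"
proof -
  define k where "k = (LEAST k. j \<le> k \<and> lam k j = lam e j)"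
  have k: "j \<le> k \<and> lam k j = lam e j" unfolding k_def by (rule LeastI[of _ e]) (use j in auto)
  have ke: "k \<le> e" unfolding k_def by (rule Least_le) (use j in auto)
  have const: "lam b j = lam e j" if "k \<le> b" "b \<le> e" for b
    using gt_column_mono[OF lam j(1), of k b] gt_column_mono[OF lam j(1), of b e] k that j by auto
  have start: "lam (k - 1) j < lam k j" if "j < k"
  proof -
    have "lam (k - 1) j \<noteq> lam e j"
      using not_less_Least[of "k - 1" "\<lambda>k. j \<le> k \<and> lam k j = lam e j"] that
      unfolding k_def[symmetric] by auto
    moreover have "lam (k - 1) j \<le> lam k j"
      using gt_column_mono[OF lam j(1), of "k - 1" k] that ke j by auto
    ultimately show ?thesis using k by simp
  qed
  \<comment> \<open>\<open>removable\<close> concerns the end of the run only. Since column j + 1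
    grows with the row index and column j is constant on the run, the strict inequality at row e
    carries back to the earlier rows.\<close>
  have below: "lam (Suc n) (Suc j) < lam n j" if n: "k \<le> n" "n \<le> e" "n < N" for n
  proof (cases "n = e")
    case True
    then show ?thesis using rem n by (simp add: removable_def)
  next
    case False
    then have ne: "n < e" using n by simp
    have 1: "lam (Suc n) (Suc j) \<le> lam e (Suc j)"
      using ne j k n by (intro gt_column_mono[OF lam]) auto
    have "lam e (Suc j) < lam e j"
    proof (cases "e < N")
      case True
      have "lam e (Suc j) \<le> lam (Suc e) (Suc j)"
        using True ne k n by (intro gt_upper[OF lam]) auto
      then show ?thesis using rem True by (simp add: removable_def)
    next
      case False
      then show ?thesis using rem j ne k n by (auto simp: removable_def)
    qed
    then show ?thesis using 1 const[of n] n by simp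
  qed
  have row: "lam n (Suc j) < lam n j" if n: "k \<le> n" "n \<le> e" "j < n" for n
  proof (cases "n < N")
    case True
    have "lam n (Suc j) \<le> lam (Suc n) (Suc j)" using True n by (intro gt_upper[OF lam]) auto
    then show ?thesis using below[OF n(1,2) True] by simp
  next
    case False
    then have "n = N" "e = N" using n j by auto
    then show ?thesis using rem n by (simp add: removable_def)
  qed
  have "run_lowered lam j k e \<in> gt N"
  proof (rule gtI)
    fix n i assume "\<not> (1 \<le> i \<and> i \<le> n \<and> n \<le> N)"
    then show "run_lowered lam j k e n i = 0"
      using gt_outside[OF lam, of i n] k j by (auto simp: run_lowered_def)
  next
    fix n i assume *: "1 \<le> i" "i < n" "n \<le> N"
    then show "run_lowered lam j k e n (Suc i) \<le> run_lowered lam j k e n i"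
      using gt_row[OF lam *] row[of n] by (auto simp: run_lowered_def)
  next
    fix n i assume *: "1 \<le> i" "i \<le> n" "n < N"
    show "run_lowered lam j k e n i \<le> run_lowered lam j k e (Suc n) i"
      using gt_upper[OF lam *] start * k by (cases "Suc n = k") (auto simp: run_lowered_def)
    show "run_lowered lam j k e (Suc n) (Suc i) \<le> run_lowered lam j k e n i"
      using gt_lower[OF lam *] below[of n] * by (auto simp: run_lowered_def)
  qed
  moreover have "lam b j = lam k j" if "b \<in> {k..e}" for b using const[of b] that k by simp
  ultimately have "valid_run N lam j k e" unfolding valid_run_def by blast
  then show ?thesis using that k ke by blast
qed

subsection \<open>Flow balance at a fixed pattern\<close>

lemma rate_nonneg:
  assumes q: "0 < q" "q < 1" and a: "0 \<le> a k" and mu: "mu \<in> gt N" and k: "1 \<le> j" "j \<le> k" "k \<le> N"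
  shows "0 \<le> rate q a mu j k"
proof -
  have pos: "q powi n \<le> 1" if "n \<ge> 0" for n
    using that q by (simp add: power_int_def power_le_one)
  have "0 \<le> (if j = 1 then 1 else 1 - q powi (mu (k-1) (j-1) - mu k j))"
    using gt_lower'[OF mu, of j k] k by (auto intro!: pos)
  moreover have "0 \<le> (if j = k then 1 else 1 - q powi (mu k j - mu k (Suc j) + 1))"
    using gt_row[OF mu, of j k] k by (auto intro!: pos)
  moreover have "0 \<le> (if j = k then 1 else 1 - q powi (mu k j - mu (k-1) j + 1))"
    using gt_upper'[OF mu, of j k] k by (auto intro!: pos)
  ultimately show ?thesis unfolding rate_def using a by (intro divide_nonneg_nonneg mult_nonneg_nonneg)
qed

lemma gen_nonneg:
  assumes q: "0 < q" "q < 1" and a: "\<And>k. k \<in> {1..N} \<Longrightarrow> 0 \<le> a k" and mu: "mu \<in> gt N" and "mu \<noteq> nu"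
  shows "0 \<le> gen q N a mu nu"
  unfolding gen_def
proof (intro sum_nonneg mult_nonneg_nonneg)
  fix k j assume "k \<in> {1..N}" "j \<in> {1..k}"
  then show "0 \<le> rate q a mu j k" using rate_nonneg[OF q a mu] by auto
qed (use assms in auto)

lemma has_sum_sum_finite:
  fixes f :: "'i \<Rightarrow> 'a \<Rightarrow> 'b::topological_comm_monoid_add"
  assumes "finite I" "\<And>i. i \<in> I \<Longrightarrow> (f i has_sum s i) A"
  shows "((\<lambda>x. \<Sum>i\<in>I. f i x) has_sum (\<Sum>i\<in>I. s i)) A"
  using assms by (induction I) (auto intro!: has_sum_add)

text \<open>Each jump adds its rate at the target and subtracts it at \<open>mu\<close>. A target
  that might leave \<open>gt N\<close> does no harm: a column blocked by its upper left neighbour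
  has rate 0.\<close>

lemma gen_row_sum:
  assumes mu: "mu \<in> gt N"
  shows "((\<lambda>nu. gen q N a mu nu) has_sum 0) (gt N)"
proof -
  have "((\<lambda>nu. rate q a mu j k * ((if nu = gt_plus N mu j k then 1 else 0) - (if nu = mu then 1 else 0)))
      has_sum 0) (gt N)" if k: "k \<in> {1..N}" "j \<in> {1..k}" for j k
  proof (cases "j = 1 \<or> mu k j < mu (k - 1) (j - 1)")
    case True
    have single: "((\<lambda>nu. if nu = x then 1 else 0) has_sum (1::real)) (gt N)" if "x \<in> gt N" for x
      using that by (intro has_sum_finite_neutralI[where B="{x}"]) auto
    have "gt_plus N mu j k \<in> gt N" using True k by (intro gt_plus_in_gt[OF mu]) auto
    from has_sum_cmult_right[OF has_sum_add[OF single[OF this] has_sum_cmult_right[OF single[OF mu], of "-1"]],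
        of "rate q a mu j k"]
    show ?thesis by simp
  next
    case False
    then have "mu (k - 1) (j - 1) = mu k j"
      using gt_lower'[OF mu, of j k] k by auto
    then have "rate q a mu j k = 0" using False by (simp add: rate_def)
    then show ?thesis by simp
  qed
  then have "((\<lambda>nu. gen q N a mu nu) has_sum (\<Sum>k\<in>{1..N}. \<Sum>j\<in>{1..k}. 0)) (gt N)"
    unfolding gen_def by (intro has_sum_sum_finite) auto
  then show ?thesis by simp
qed

text \<open>The triples j <= k <= e are regrouped from first row k to last row e; for fixed (e, j)
  at most one k will contribute.\<close>

lemma sum_triangle_swap:
  "(\<Sum>k\<in>{1..N}. \<Sum>j\<in>{1..k}. \<Sum>e\<in>{k..N}. V j k e) = (\<Sum>e\<in>{1..N}. \<Sum>j\<in>{1..e}. \<Sum>k\<in>{j..e}. V j k e)"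
  for V :: "nat \<Rightarrow> nat \<Rightarrow> nat \<Rightarrow> 'a::comm_monoid_add"
proof -
  have "(\<Sum>k\<in>{1..N}. \<Sum>j\<in>{1..k}. \<Sum>e\<in>{k..N}. V j k e) =
    (\<Sum>(k, j, e)\<in>(SIGMA k:{1..N}. SIGMA j:{1..k}. {k..N}). V j k e)"
    by (simp add: sum.Sigma)
  also have "\<dots> = (\<Sum>(e, j, k)\<in>(SIGMA e:{1..N}. SIGMA j:{1..e}. {j..e}). V j k e)"
    by (rule sum.reindex_bij_witness[where i="\<lambda>(e, j, k). (k, j, e)" and j="\<lambda>(k, j, e). (e, j, k)"]) auto
  also have "\<dots> = (\<Sum>e\<in>{1..N}. \<Sum>j\<in>{1..e}. \<Sum>k\<in>{j..e}. V j k e)"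
    by (simp add: sum.Sigma)
  finally show ?thesis .
qed

section \<open>Weight ratios along a run and the outflow of a row\<close>

context q_param
begin

definition weight :: "nat \<Rightarrow> (nat \<Rightarrow> real) \<Rightarrow> (nat \<Rightarrow> nat \<Rightarrow> int) \<Rightarrow> complex" where
  "weight n a g = (\<Prod>j\<in>{1..n}. Pskew q j (g j) (g (j-1)) (complex_of_real (a j)))"

lemma weight_Suc:
  "weight (Suc n) a g = weight n a g * Pskew q (Suc n) (g (Suc n)) (g n) (complex_of_real (a (Suc n)))"
  by (simp add: weight_def prod.nat_ivl_Suc')

lemma rate_complex:
  "complex_of_real (rate q a mu j k) =
     of_real (a k) * (if j = 1 then 1 else om (mu (k-1) (j-1) - mu k j))
         * (if j = k then 1 else om (mu k j - mu k (Suc j) + 1))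
         / (if j = k then 1 else om (mu k j - mu (k-1) j + 1))"
  by (simp only: rate_def of_real_mult of_real_divide if_distrib[of complex_of_real]
      of_real_diff of_real_1 of_real_power_int)

text \<open>The rate belongs to the pattern before the jump; rewriting it in entries of the pattern
  after the jump absorbs the shifts by 1.\<close>

lemma rate_run_lowered:
  assumes "1 \<le> j" "j \<le> k" "k \<le> e"
  shows "complex_of_real (rate q a (run_lowered lam j k e) j k) =
    of_real (a k) * gap_above (lam (k-1)) (lam k) j * gap_below k (lam k) j /
      (if j = k then 1 else om (lam k j - lam (k-1) j))"
proof -
  let ?D = "run_lowered lam j k e"
  have D: "?D k j = lam k j - 1" "?D (k-1) (j-1) = lam (k-1) (j-1)"
    "?D k (Suc j) = lam k (Suc j)" "?D (k-1) j = lam (k-1) j"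
    using assms by (auto simp: run_lowered_def)
  have *: "x - (y - 1) = x - y + 1" "(y - 1) - x + 1 = y - x" for x y :: int by simp_all
  show ?thesis unfolding rate_complex D * gap_above_def gap_below_def by (rule refl)
qed

text \<open>Each row inside the run changes the skew weight by the ratio of two consecutive
  \<open>gap_above\<close> factors, so that the product over the run telescopes.\<close>
lemma weight_run_lowered_partial:
  assumes lam: "lam \<in> gt N" and j: "1 \<le> j" "j \<le> k" "k \<le> e" "e \<le> N"
    and v: "valid_run N lam j k e" and a: "\<And>n. n \<in> {1..N} \<Longrightarrow> a n \<noteq> 0"
    and m: "k \<le> m" "m \<le> e"
  shows "complex_of_real (rate q a (run_lowered lam j k e) j k) * weight m a (run_lowered lam j k e) =
     gap_above (lam m) (lam m) j * weight m a lam"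
  using m
proof (induction m rule: dec_induct)
  case base
  let ?D = "run_lowered lam j k e"
  obtain k' where k': "k = Suc k'" using j by (cases k) auto
  have D: "?D k = decr j (lam k)" "?D k' = lam k'" using j k' by (simp_all add: run_lowered_row)
  have w: "weight k' a ?D = weight k' a lam"
    unfolding weight_def
  proof (rule prod.cong[OF refl])
    fix x assume "x \<in> {1..k'}"
    then have "\<not> k \<le> x" "\<not> k \<le> x - 1" using k' by auto
    then show "Pskew q x (?D x) (?D (x - 1)) (a x) = Pskew q x (lam x) (lam (x - 1)) (a x)"
      by (simp add: run_lowered_row)
  qed
  have start: "lam k' j < lam k j" if "j < k"
    using valid_run_start[OF lam j(1) that j(3,4) v] k' by simp
  have lt: "lam k (Suc j) < lam k j" if "j < k"
    using gt_row[OF valid_run_gt[OF v], of j k] that j by (auto simp: run_lowered_def)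
  have ak: "complex_of_real (a k) \<noteq> 0" using a[of k] j by auto
  have R: "Pskew q k (decr j (lam k)) (lam k') (a k) * a k * gap_below k (lam k) j * gap_above (lam k') (lam k) j =
     Pskew q k (lam k) (lam k') (a k) * gap_above (lam k) (lam k) j * (if j = k then 1 else om (lam k j - lam k' j))"
  proof (rule Pskew_decr_upper)
    show "lam k j \<le> lam k (j - 1)" if "1 < j"
      using gt_row[OF lam, of "j - 1" k] that j by auto
  qed (use j lt ak in auto)
  \<comment> \<open>The denominator of the rate is nonzero because a valid run starts at a strict
    increase of its column.\<close>
  have nz: "(if j = k then 1 else om (lam k j - lam k' j)) \<noteq> 0"
    using om_nz[of "lam k j - lam k' j"] start j by auto
  define b where "b = (if j = k then 1 else om (lam k j - lam k' j))"
  have b: "b \<noteq> 0" using nz unfolding b_def .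
  have k1: "k - 1 = k'" using k' by simp
  have wk: "weight k a ?D = weight k' a lam * Pskew q k (decr j (lam k)) (lam k') (a k)"
    "weight k a lam = weight k' a lam * Pskew q k (lam k) (lam k') (a k)"
    using weight_Suc[of k' a ?D] weight_Suc[of k' a lam] by (simp_all add: D w flip: k')
  have rt: "complex_of_real (rate q a ?D j k) =
      a k * gap_above (lam k') (lam k) j * gap_below k (lam k) j / b"
    using rate_run_lowered[OF j(1-3), of a lam] unfolding b_def k1 .
  have "complex_of_real (rate q a ?D j k) * weight k a ?D =
     weight k' a lam * (Pskew q k (decr j (lam k)) (lam k') (a k) * a k * gap_below k (lam k) j *
       gap_above (lam k') (lam k) j) / b"
    unfolding rt wk times_divide_eq_left times_divide_eq_right by (simp only: mult_ac)
  also have "\<dots> = gap_above (lam k) (lam k) j * weight k a lam"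
    unfolding R[folded b_def] wk
    by (simp only: mult.assoc[symmetric] nonzero_mult_div_cancel_right[OF b]) (simp only: mult_ac)
  finally show ?case .
next
  case (step m)
  let ?D = "run_lowered lam j k e" and ?n = "Suc m"
  have km: "k \<le> m" "m < e" "m \<le> e" "Suc m \<le> e" using step.hyps(1) step.prems by auto
  have IH: "complex_of_real (rate q a ?D j k) * weight m a ?D = gap_above (lam m) (lam m) j * weight m a lam"
    by (rule step.IH[OF km(3)])
  have D: "?D ?n = decr j (lam ?n)" "?D m = decr j (lam m)" using km by (simp_all add: run_lowered_row)
  have eq: "lam ?n j = lam m j"
    using valid_run_const[OF v, of m] valid_run_const[OF v, of ?n] km by (metis atLeastAtMost_iff le_SucI)
  have an: "complex_of_real (a ?n) \<noteq> 0" using a[of ?n] km j by auto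
  have lt: "lam ?n (Suc j) < lam ?n j"
    using gt_row[OF valid_run_gt[OF v], of j ?n] km j by (auto simp: run_lowered_def split: if_splits)
  have R1: "Pskew q ?n (decr j (lam ?n)) (decr j (lam m)) (a ?n) * a ?n * gap_below ?n (lam ?n) j * gap_above (decr j (lam m)) (lam ?n) j =
     Pskew q ?n (lam ?n) (decr j (lam m)) (a ?n) * gap_above (lam ?n) (lam ?n) j * (if j = ?n then 1 else om (lam ?n j - decr j (lam m) j))"
  proof (rule Pskew_decr_upper)
    show "lam ?n j \<le> lam ?n (j - 1)" if "1 < j"
      using gt_row[OF lam, of "j - 1" ?n] that j km by auto
  qed (use j km lt an in auto)
  have R2: "Pskew q ?n (lam ?n) (decr j (lam m)) (a ?n) * om (lam ?n j - lam m j + 1) =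
     a ?n * Pskew q ?n (lam ?n) (lam m) (a ?n) * om (lam m j - lam ?n (Suc j))"
    by (rule Pskew_decr_lower) (use j km an in auto)
  \<comment> \<open>Lowering column j leaves column j - 1 alone, and column j is constant on the
    run, so the factor of row \<open>?n\<close> against the row beneath equals the factor carried
    over from row m.\<close>
  have ga: "gap_above (decr j (lam m)) (lam ?n) j = gap_above (lam m) (lam m) j"
    using j by (auto simp: gap_above_def decr_def eq)
  have gb: "gap_below ?n (lam ?n) j = om (lam m j - lam ?n (Suc j))"
    using j km by (auto simp: gap_below_def eq)
  have gb_nz: "om (lam m j - lam ?n (Suc j)) \<noteq> 0" using lt eq by (intro om_nz) auto
  have "Pskew q ?n (decr j (lam ?n)) (decr j (lam m)) (a ?n) * gap_above (lam m) (lam m) j *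
      (a ?n * om (lam m j - lam ?n (Suc j))) =
      (Pskew q ?n (lam ?n) (decr j (lam m)) (a ?n) * om (lam ?n j - lam m j + 1)) * gap_above (lam ?n) (lam ?n) j"
  proof -
    have "(if j = ?n then 1 else om (lam ?n j - decr j (lam m) j)) = om (lam ?n j - lam m j + 1)"
      using j km by (simp add: decr_def algebra_simps)
    then show ?thesis using R1 unfolding ga gb by (simp only: mult_ac)
  qed
  also have "\<dots> = Pskew q ?n (lam ?n) (lam m) (a ?n) * gap_above (lam ?n) (lam ?n) j *
      (a ?n * om (lam m j - lam ?n (Suc j)))"
    unfolding R2 by (simp only: mult_ac)
  finally have R: "Pskew q ?n (decr j (lam ?n)) (decr j (lam m)) (a ?n) * gap_above (lam m) (lam m) j =
      Pskew q ?n (lam ?n) (lam m) (a ?n) * gap_above (lam ?n) (lam ?n) j"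
    using mult_right_cancel[OF no_zero_divisors[OF an gb_nz]] by blast
  have "complex_of_real (rate q a ?D j k) * weight ?n a ?D =
     (complex_of_real (rate q a ?D j k) * weight m a ?D) * Pskew q ?n (decr j (lam ?n)) (decr j (lam m)) (a ?n)"
    unfolding weight_Suc D by (simp only: mult_ac)
  also have "\<dots> = weight m a lam * (Pskew q ?n (decr j (lam ?n)) (decr j (lam m)) (a ?n) * gap_above (lam m) (lam m) j)"
    unfolding IH by (simp only: mult_ac)
  also have "\<dots> = gap_above (lam ?n) (lam ?n) j * weight ?n a lam"
    unfolding R weight_Suc by (simp only: mult_ac)
  finally show ?case .
qed

text \<open>Multiplied by a_(e+1), this is the inflow through the runs of column j ending in row e,
  relative to the current weight. The same expression is the non-telescoping part of the outflow
  rate of row e + 1.\<close>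

definition blocked_rate :: "(nat \<Rightarrow> nat \<Rightarrow> int) \<Rightarrow> nat \<Rightarrow> nat \<Rightarrow> complex" where
  "blocked_rate lam e j = gap_above (lam e) (lam e) j * om (lam e j - lam (Suc e) (Suc j)) /
     om (lam (Suc e) j - lam e j + 1)"

text \<open>Above the run only the skew weight of row e + 1 changes, since its lower neighbour is
  lowered; \<open>Pskew_decr_lower\<close> gives that ratio, and all higher rows contribute the same
  factor to both sides.\<close>

lemma weight_run_lowered_inner:
  assumes lam: "lam \<in> gt N" and j: "1 \<le> j" "j \<le> k" "k \<le> e" "e < N"
    and v: "valid_run N lam j k e" and a: "\<And>n. n \<in> {1..N} \<Longrightarrow> a n \<noteq> 0"
  shows "complex_of_real (rate q a (run_lowered lam j k e) j k) * weight N a (run_lowered lam j k e) =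
     a (Suc e) * blocked_rate lam e j * weight N a lam"
proof -
  let ?D = "run_lowered lam j k e" and ?n = "Suc e"
  have "complex_of_real (rate q a ?D j k) * weight m a ?D = a (Suc e) * blocked_rate lam e j * weight m a lam"
    if "Suc e \<le> m" for m
    using that
  proof (induction m rule: dec_induct)
    case base
    have an: "complex_of_real (a ?n) \<noteq> 0" using a[of ?n] j by auto
    have nz: "om (lam ?n j - lam e j + 1) \<noteq> 0"
      using gt_upper[OF lam, of j e] j by (intro om_nz) auto
    have R2: "Pskew q ?n (lam ?n) (decr j (lam e)) (a ?n) * om (lam ?n j - lam e j + 1) =
       a ?n * Pskew q ?n (lam ?n) (lam e) (a ?n) * om (lam e j - lam ?n (Suc j))"
      by (rule Pskew_decr_lower) (use j an in auto)
    then have R: "Pskew q ?n (lam ?n) (decr j (lam e)) (a ?n) = 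
       a ?n * Pskew q ?n (lam ?n) (lam e) (a ?n) * om (lam e j - lam ?n (Suc j)) / om (lam ?n j - lam e j + 1)"
      using nz by (simp add: eq_divide_eq)
    have D: "?D ?n = lam ?n" "?D e = decr j (lam e)" using j by (simp_all add: run_lowered_row)
    have "complex_of_real (rate q a ?D j k) * weight ?n a ?D =
      (complex_of_real (rate q a ?D j k) * weight e a ?D) * Pskew q ?n (lam ?n) (decr j (lam e)) (a ?n)"
      unfolding weight_Suc D by (simp only: mult_ac)
    also have "complex_of_real (rate q a ?D j k) * weight e a ?D = gap_above (lam e) (lam e) j * weight e a lam"
      by (rule weight_run_lowered_partial[OF lam _ _ _ _ v]) (use j a in auto)
    finally show ?case unfolding R weight_Suc blocked_rate_def by (simp add: mult_ac)
  next
    case (step m)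
    have "?D (Suc m) = lam (Suc m)" "?D m = lam m" using step by (simp_all add: run_lowered_row)
    then show ?case unfolding weight_Suc using step by (simp add: mult.assoc[symmetric])
  qed
  then show ?thesis using j by simp
qed

text \<open>Exactly one start exists when the end is removable and none otherwise, so a value
  independent of the start survives as the whole sum.\<close>

lemma sum_valid_runs:
  assumes lam: "lam \<in> gt N" and j: "1 \<le> j" "j \<le> e" "e \<le> N" and a: "\<And>n. n \<in> {1..N} \<Longrightarrow> a n \<noteq> 0"
    and F: "\<And>k. k \<in> {j..e} \<Longrightarrow> valid_run N lam j k e \<Longrightarrow> F k = c"
    and c: "\<not> removable N lam j e \<Longrightarrow> c = (0::complex)"
  shows "(\<Sum>k\<in>{j..e}. if valid_run N lam j k e then F k else 0) = c"
proof (cases "removable N lam j e")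
  case True
  then obtain k where k: "j \<le> k" "k \<le> e" "valid_run N lam j k e"
    using valid_run_exists[OF lam j] by blast
  have "(\<Sum>k'\<in>{j..e}. if valid_run N lam j k' e then F k' else 0) = (\<Sum>k'\<in>{j..e}. if k' = k then F k else 0)"
  proof (rule sum.cong[OF refl])
    fix k' assume "k' \<in> {j..e}"
    then have "valid_run N lam j k' e \<longleftrightarrow> k' = k"
      using valid_run_unique[OF lam j(1), of k' e k] j k by auto
    then show "(if valid_run N lam j k' e then F k' else 0) = (if k' = k then F k else 0)" by auto
  qed
  also have "\<dots> = c" using k F by simp
  finally show ?thesis .
next
  case False
  then have "\<not> valid_run N lam j k e" if "k \<in> {j..e}" for k
    using valid_run_removable[OF j(1) _ _ j(3)] that by auto
  then show ?thesis using c[OF False] by (intro trans[OF sum.neutral]) auto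
qed

text \<open>The limit a -> +infinity of \<open>telescoping_identity\<close>, for the first
  column.\<close>

lemma telescoping_identity_first:
  "om (b - d + 1) = om (c - d) + qc powi (c - d) * om (b - c + 1)"
proof -
  have "qc powi (c - d) * qc powi (b - c + 1) = qc powi ((c - d) + (b - c + 1))"
    by (rule power_int_add[symmetric]) simp
  also have "(c - d) + (b - c + 1) = b - d + 1" by simp
  finally show ?thesis by (simp add: right_diff_distrib)
qed

text \<open>For j < k the rate divided by a_k is \<open>blocked_rate\<close> in row k - 1 plus
  v_(j+1) - v_j, and for j = k it is 1 - v_k. The differences telescope to v_k, where v_1 = 0
  expresses the convention of an infinite entry at index 0, and only the constant 1 remains besides
  the blocked rates.\<close>

lemma sum_rates:
  assumes lam: "lam \<in> gt N" and k: "1 \<le> k" "k \<le> N"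
  shows "(\<Sum>j\<in>{1..k}. complex_of_real (rate q a lam j k)) =
     of_real (a k) * (1 + (\<Sum>j\<in>{1..k-1}. blocked_rate lam (k-1) j))"
proof -
  obtain k' where k': "k = Suc k'" using k by (cases k) auto
  define v where "v = (\<lambda>j. if j = 1 then 0 else qc powi (lam k' (j-1) - lam k j))"
  have step: "complex_of_real (rate q a lam j k) = a k * (blocked_rate lam k' j + (v (Suc j) - v j))"
    if j: "j \<in> {1..k'}" for j
  proof -
    let ?d = "om (lam k j - lam k' j + 1)"
    have nz: "?d \<noteq> 0"
      using gt_upper[OF lam, of j k'] j k k' by (intro om_nz) auto
    have "(1 - v j) * om (lam k j - lam k (Suc j) + 1) =
       gap_above (lam k') (lam k') j * om (lam k' j - lam k (Suc j)) + (v (Suc j) - v j) * ?d"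
    proof (cases "j = 1")
      case True
      then show ?thesis
        using telescoping_identity_first[of "lam k j" "lam k (Suc j)" "lam k' j"]
        by (simp add: v_def gap_above_def)
    next
      case False
      have *: "y = x + (w - z) * d" if "x - y = (z - w) * d" for x y z w d :: complex
        using that by (simp add: algebra_simps)
      have e: "lam k j + 1 - lam k (Suc j) = lam k j - lam k (Suc j) + 1" by simp
      show ?thesis
        using *[OF telescoping_identity[of "lam k' (j-1)" "lam k' j" "lam k (Suc j)" "lam k j"]] False j
        unfolding e by (simp add: v_def gap_above_def mult.commute)
    qed
    then have "(1 - v j) * om (lam k j - lam k (Suc j) + 1) / ?d = blocked_rate lam k' j + (v (Suc j) - v j)"
      unfolding blocked_rate_def using nz by (simp add: k' add_divide_distrib)
    moreover have "complex_of_real (rate q a lam j k) = a k * ((1 - v j) * om (lam k j - lam k (Suc j) + 1) / ?d)"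
    proof -
      have v: "1 - v j = (if j = 1 then 1 else om (lam (k - 1) (j - 1) - lam k j))"
        by (simp add: v_def k')
      have jk: "j \<noteq> k" using j k' by simp
      have k1: "k - 1 = k'" using k' by simp
      show ?thesis
        unfolding rate_complex v[symmetric] unfolding k1
        by (simp only: jk if_False mult.assoc times_divide_eq_right)
    qed
    ultimately show ?thesis by simp
  qed
  have last: "complex_of_real (rate q a lam k k) = a k * (1 - v k)"
  proof -
    have "1 - v k = (if k = 1 then 1 else om (lam (k - 1) (k - 1) - lam k k))"
      by (simp add: v_def k')
    then show ?thesis unfolding rate_complex by (simp only: if_True refl mult_1_right div_by_1)
  qed
  have tel: "(\<Sum>j\<in>{1..k'}. v (Suc j) - v j) = v (Suc k')"
  proof -
    have "(\<Sum>j\<in>{1..k'}. v (Suc j) - v j) = v (Suc k') - v 1" by (induction k') auto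
    then show ?thesis by (simp add: v_def)
  qed
  have "(\<Sum>j\<in>{1..k}. complex_of_real (rate q a lam j k)) =
    (\<Sum>j\<in>{1..k'}. complex_of_real (rate q a lam j k)) + complex_of_real (rate q a lam k k)"
    unfolding k' by (simp add: sum.nat_ivl_Suc')
  also have "\<dots> = (\<Sum>j\<in>{1..k'}. a k * (blocked_rate lam k' j + (v (Suc j) - v j))) + a k * (1 - v k)"
    using step last by simp
  also have "\<dots> = a k * ((\<Sum>j\<in>{1..k'}. blocked_rate lam k' j) + (\<Sum>j\<in>{1..k'}. v (Suc j) - v j)) + a k * (1 - v k)"
    by (simp only: sum_distrib_left[symmetric] sum.distrib)
  also have "\<dots> = a k * (1 + (\<Sum>j\<in>{1..k'}. blocked_rate lam k' j))"
    unfolding tel by (simp add: k' algebra_simps)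
  finally show ?thesis by (simp add: k')
qed

end

section \<open>Total flows and the forward equation\<close>

context q_param
begin

lemma sum_all_rates:
  assumes lam: "lam \<in> gt N"
  shows "(\<Sum>k\<in>{1..N}. \<Sum>j\<in>{1..k}. complex_of_real (rate q a lam j k)) =
    (\<Sum>k\<in>{1..N}. complex_of_real (a k)) +
    (\<Sum>e\<in>{1..<N}. \<Sum>j\<in>{1..e}. a (Suc e) * blocked_rate lam e j)"
proof -
  have "(\<Sum>k\<in>{1..N}. \<Sum>j\<in>{1..k}. complex_of_real (rate q a lam j k)) =
      (\<Sum>k\<in>{1..N}. of_real (a k) * (1 + (\<Sum>j\<in>{1..k-1}. blocked_rate lam (k-1) j)))"
    by (intro sum.cong refl sum_rates[OF lam]) auto
  also have "\<dots> = (\<Sum>k\<in>{1..N}. complex_of_real (a k)) +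
      (\<Sum>k\<in>{1..N}. of_real (a k) * (\<Sum>j\<in>{1..k-1}. blocked_rate lam (k-1) j))"
    by (simp add: distrib_left sum.distrib)
  also have "(\<Sum>k\<in>{1..N}. of_real (a k) * (\<Sum>j\<in>{1..k-1}. blocked_rate lam (k-1) j)) =
      (\<Sum>e\<in>{1..<N}. \<Sum>j\<in>{1..e}. a (Suc e) * blocked_rate lam e j)"
  proof (cases N)
    case (Suc n)
    show ?thesis unfolding Suc sum_Suc_split by (simp add: sum_distrib_left atLeastLessThanSuc_atLeastAtMost)
  qed simp
  finally show ?thesis .
qed

lemma Pt_eq:
  "Pt q N M a alpha t g = weight N a g * Q_fn q N M alpha t (g N) *
     inverse (Pi_fn q N M alpha t (\<lambda>j. complex_of_real (a j)))"
  by (simp add: Pt_def weight_def divide_inverse)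

lemma inverse_Pi_fn_derivative:
  "((\<lambda>s. inverse (Pi_fn q N M alpha s z)) has_vector_derivative
      - (\<Sum>j\<in>{1..N}. z j) * inverse (Pi_fn q N M alpha t z)) (at t)"
proof -
  let ?A = "\<Sum>j\<in>{1..N}. z j"
  have eq: "inverse (Pi_fn q N M alpha s z) = inverse (cauchy_factor N M alpha z) * exp (s *\<^sub>R (- ?A))" for s
    unfolding Pi_fn_eq by (simp add: exp_minus scaleR_conv_of_real mult.commute)
  have "((\<lambda>s. inverse (cauchy_factor N M alpha z) * exp (s *\<^sub>R (- ?A))) has_vector_derivative
     inverse (cauchy_factor N M alpha z) * (exp (t *\<^sub>R (- ?A)) * (- ?A))) (at t)"
    by (intro has_vector_derivative_mult_right exp_scaleR_has_vector_derivative_right)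
  then show ?thesis unfolding eq by (simp add: mult_ac)
qed

text \<open>Runs ending below row N keep the top row, hence the value of Q, and give a multiple of
  the probability of \<open>lam\<close>. Runs ending in row N lower the top row and give the terms
  of the derivative of Q.\<close>

lemma sum_inflow:
  assumes lam: "lam \<in> gt N" and a: "\<And>n. n \<in> {1..N} \<Longrightarrow> a n \<noteq> 0"
  shows "(\<Sum>k\<in>{1..N}. \<Sum>j\<in>{1..k}. \<Sum>e\<in>{k..N}. if valid_run N lam j k e then
      Pt q N M a alpha t (run_lowered lam j k e) *
        complex_of_real (rate q a (run_lowered lam j k e) j k) else 0) =
    Pt q N M a alpha t lam * (\<Sum>e\<in>{1..<N}. \<Sum>j\<in>{1..e}. a (Suc e) * blocked_rate lam e j) +
    weight N a lam * (\<Sum>j\<in>{1..N}. gap_above (lam N) (lam N) j * Q_fn q N M alpha t (decr j (lam N))) *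
      inverse (Pi_fn q N M alpha t (\<lambda>j. complex_of_real (a j)))"
proof -
  define E where "E = inverse (Pi_fn q N M alpha t (\<lambda>j. complex_of_real (a j)))"
  define Q where "Q = Q_fn q N M alpha t"
  define V where "V = (\<lambda>j k e. if valid_run N lam j k e then
      Pt q N M a alpha t (run_lowered lam j k e) *
        complex_of_real (rate q a (run_lowered lam j k e) j k) else 0)"
  have P: "Pt q N M a alpha t g = weight N a g * Q (g N) * E" for g
    unfolding Pt_eq E_def Q_def ..
  have inner: "(\<Sum>k\<in>{j..e}. V j k e) = Pt q N M a alpha t lam * (a (Suc e) * blocked_rate lam e j)"
    if j: "1 \<le> j" "j \<le> e" "e < N" for j e
    unfolding V_def
  proof (rule sum_valid_runs[where N=N and a=a, OF lam])
    fix k assume k: "k \<in> {j..e}" and v: "valid_run N lam j k e"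
    have "run_lowered lam j k e N = lam N" using j by (simp add: run_lowered_row)
    moreover have "complex_of_real (rate q a (run_lowered lam j k e) j k) * weight N a (run_lowered lam j k e) =
        a (Suc e) * blocked_rate lam e j * weight N a lam"
      by (rule weight_run_lowered_inner[OF lam _ _ _ _ v]) (use j k a in auto)
    ultimately show "Pt q N M a alpha t (run_lowered lam j k e) * complex_of_real (rate q a (run_lowered lam j k e) j k) =
       Pt q N M a alpha t lam * (a (Suc e) * blocked_rate lam e j)"
      unfolding P by (simp add: mult_ac)
  next
    assume "\<not> removable N lam j e"
    then have "lam (Suc e) (Suc j) = lam e j"
      using gt_lower[OF lam j] j by (simp add: removable_def)
    then show "Pt q N M a alpha t lam * (a (Suc e) * blocked_rate lam e j) = 0"
      by (simp add: blocked_rate_def)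
  qed (use j a in auto)
  have top: "(\<Sum>k\<in>{j..N}. V j k N) = weight N a lam * (gap_above (lam N) (lam N) j * Q (decr j (lam N))) * E"
    if j: "1 \<le> j" "j \<le> N" for j
    unfolding V_def
  proof (rule sum_valid_runs[where N=N and a=a, OF lam])
    fix k assume k: "k \<in> {j..N}" and v: "valid_run N lam j k N"
    have "run_lowered lam j k N N = decr j (lam N)" using k by (simp add: run_lowered_row)
    moreover have "complex_of_real (rate q a (run_lowered lam j k N) j k) * weight N a (run_lowered lam j k N) =
        gap_above (lam N) (lam N) j * weight N a lam"
      by (rule weight_run_lowered_partial[OF lam _ _ _ _ v]) (use j k a in auto)
    ultimately show "Pt q N M a alpha t (run_lowered lam j k N) * complex_of_real (rate q a (run_lowered lam j k N) j k) =
       weight N a lam * (gap_above (lam N) (lam N) j * Q (decr j (lam N))) * E"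
      unfolding P by (simp add: mult_ac)
  next
    assume "\<not> removable N lam j N"
    then have jN: "j < N" and "lam N (Suc j) = lam N j"
      using gt_row[OF lam, of j N] j by (auto simp: removable_def)
    then have "Q (decr j (lam N)) = 0" unfolding Q_def using j by (intro Q_fn_decr_eq_0) auto
    then show "weight N a lam * (gap_above (lam N) (lam N) j * Q (decr j (lam N))) * E = 0" by simp
  qed (use j a in auto)
  have "(\<Sum>k\<in>{1..N}. \<Sum>j\<in>{1..k}. \<Sum>e\<in>{k..N}. V j k e) = (\<Sum>e\<in>{1..N}. \<Sum>j\<in>{1..e}. \<Sum>k\<in>{j..e}. V j k e)"
    by (rule sum_triangle_swap)
  also have "\<dots> = (\<Sum>e\<in>{1..<N}. \<Sum>j\<in>{1..e}. \<Sum>k\<in>{j..e}. V j k e) + (\<Sum>j\<in>{1..N}. \<Sum>k\<in>{j..N}. V j k N)"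
    by (cases N) (simp_all add: sum.nat_ivl_Suc' atLeastLessThanSuc_atLeastAtMost add.commute)
  also have "(\<Sum>e\<in>{1..<N}. \<Sum>j\<in>{1..e}. \<Sum>k\<in>{j..e}. V j k e) =
      (\<Sum>e\<in>{1..<N}. \<Sum>j\<in>{1..e}. Pt q N M a alpha t lam * (a (Suc e) * blocked_rate lam e j))"
    by (intro sum.cong refl inner) auto
  also have "\<dots> = Pt q N M a alpha t lam * (\<Sum>e\<in>{1..<N}. \<Sum>j\<in>{1..e}. a (Suc e) * blocked_rate lam e j)"
    by (simp only: sum_distrib_left)
  also have "(\<Sum>j\<in>{1..N}. \<Sum>k\<in>{j..N}. V j k N) =
      (\<Sum>j\<in>{1..N}. weight N a lam * (gap_above (lam N) (lam N) j * Q (decr j (lam N))) * E)"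
    by (intro sum.cong refl top) auto
  also have "\<dots> = weight N a lam * (\<Sum>j\<in>{1..N}. gap_above (lam N) (lam N) j * Q (decr j (lam N))) * E"
    by (simp only: sum_distrib_left sum_distrib_right)
  finally show ?thesis by (simp only: V_def E_def Q_def)
qed

text \<open>Only the preimages of \<open>lam\<close> contribute, at most one for each last row e, so
  the sum over \<open>gt N\<close> has finite support.\<close>

lemma has_sum_inflow:
  fixes f :: "(nat \<Rightarrow> nat \<Rightarrow> int) \<Rightarrow> complex"
  assumes lam: "lam \<in> gt N" and j: "1 \<le> j" "j \<le> k" "k \<le> N"
  shows "((\<lambda>mu. f mu * (if lam = gt_plus N mu j k then 1 else 0)) has_sum
     (\<Sum>e\<in>{k..N}. if valid_run N lam j k e then f (run_lowered lam j k e) else 0)) (gt N)"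
proof (rule has_sum_finite_neutralI[where B = "{mu \<in> gt N. gt_plus N mu j k = lam}"])
  note bij = gt_plus_preimage[OF lam j]
  show "finite {mu \<in> gt N. gt_plus N mu j k = lam}"
    using bij_betw_finite[OF bij] by simp
  have "(\<Sum>mu\<in>{mu \<in> gt N. gt_plus N mu j k = lam}. f mu * (if lam = gt_plus N mu j k then 1 else 0)) =
     (\<Sum>mu\<in>{mu \<in> gt N. gt_plus N mu j k = lam}. f mu)"
    by (intro sum.cong) auto
  also have "\<dots> = (\<Sum>e\<in>{e \<in> {k..N}. valid_run N lam j k e}. f (run_lowered lam j k e))"
    by (rule sum.reindex_bij_betw[OF bij, symmetric])
  also have "\<dots> = (\<Sum>e\<in>{k..N}. if valid_run N lam j k e then f (run_lowered lam j k e) else 0)"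
    by (simp only: sum.inter_filter finite_atLeastAtMost)
  finally show "(\<Sum>e\<in>{k..N}. if valid_run N lam j k e then f (run_lowered lam j k e) else 0) =
     (\<Sum>mu\<in>{mu \<in> gt N. gt_plus N mu j k = lam}. f mu * (if lam = gt_plus N mu j k then 1 else 0))" ..
qed auto

text \<open>With A the sum of the a_k and B the sum of the blocked terms, the inner runs give P B
  and the outflow is P (A + B), so P B cancels. What remains is the product rule: - A comes from 1 /
  Pi, and the runs ending in row N give the derivative of Q.\<close>

lemma forward_equation:
  assumes lam: "lam \<in> gt N" and a: "\<And>n. n \<in> {1..N} \<Longrightarrow> a n \<noteq> 0"
    and alpha: "\<And>i. i \<in> {1..M} \<Longrightarrow> N > 0 \<Longrightarrow> \<bar>alpha i\<bar> < 1"
  shows "\<exists>D. ((\<lambda>mu. Pt q N M a alpha t mu * complex_of_real (gen q N a mu lam)) has_sum D) (gt N)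
     \<and> ((\<lambda>s. Pt q N M a alpha s lam) has_vector_derivative D) (at t)"
proof -
  define A where "A = (\<Sum>k\<in>{1..N}. complex_of_real (a k))"
  define B where "B = (\<Sum>e\<in>{1..<N}. \<Sum>j\<in>{1..e}. a (Suc e) * blocked_rate lam e j)"
  define E where "E = (\<lambda>t. inverse (Pi_fn q N M alpha t (\<lambda>j. complex_of_real (a j))))"
  define S where "S = (\<Sum>j\<in>{1..N}. gap_above (lam N) (lam N) j * Q_fn q N M alpha t (decr j (lam N)))"
  define P where "P = Pt q N M a alpha t"
  define D where "D = weight N a lam * S * E t - A * P lam"
  let ?R = "\<lambda>mu j k. complex_of_real (rate q a mu j k)"
  have jump: "((\<lambda>mu. P mu * ?R mu j k * (if lam = gt_plus N mu j k then 1 else 0) +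
       (- 1) * (P mu * ?R mu j k * (if lam = mu then 1 else 0))) has_sum
      (\<Sum>e\<in>{k..N}. if valid_run N lam j k e then P (run_lowered lam j k e) * ?R (run_lowered lam j k e) j k else 0) +
       (- 1) * (P lam * ?R lam j k)) (gt N)"
    if "k \<in> {1..N}" "j \<in> {1..k}" for j k
  proof (intro has_sum_add has_sum_cmult_right)
    show "((\<lambda>mu. P mu * ?R mu j k * (if lam = gt_plus N mu j k then 1 else 0)) has_sum
      (\<Sum>e\<in>{k..N}. if valid_run N lam j k e then P (run_lowered lam j k e) * ?R (run_lowered lam j k e) j k else 0)) (gt N)"
      using that by (intro has_sum_inflow[OF lam]) auto
    show "((\<lambda>mu. P mu * ?R mu j k * (if lam = mu then 1 else 0)) has_sum P lam * ?R lam j k) (gt N)"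
      by (rule has_sum_finite_neutralI[where B="{lam}"]) (use lam in auto)
  qed
  have "((\<lambda>mu. \<Sum>k\<in>{1..N}. \<Sum>j\<in>{1..k}. P mu * ?R mu j k * (if lam = gt_plus N mu j k then 1 else 0) +
       (- 1) * (P mu * ?R mu j k * (if lam = mu then 1 else 0))) has_sum
      (\<Sum>k\<in>{1..N}. \<Sum>j\<in>{1..k}. (\<Sum>e\<in>{k..N}. if valid_run N lam j k e then P (run_lowered lam j k e) * ?R (run_lowered lam j k e) j k else 0) +
       (- 1) * (P lam * ?R lam j k))) (gt N)"
    by (intro has_sum_sum_finite jump) auto
  moreover have "(\<Sum>k\<in>{1..N}. \<Sum>j\<in>{1..k}. P mu * ?R mu j k * (if lam = gt_plus N mu j k then 1 else 0) +
       (- 1) * (P mu * ?R mu j k * (if lam = mu then 1 else 0))) = P mu * complex_of_real (gen q N a mu lam)" for mu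
    unfolding gen_def of_real_sum sum_distrib_left by (intro sum.cong refl) simp
  moreover have "(\<Sum>k\<in>{1..N}. \<Sum>j\<in>{1..k}. (\<Sum>e\<in>{k..N}. if valid_run N lam j k e then P (run_lowered lam j k e) * ?R (run_lowered lam j k e) j k else 0) +
       (- 1) * (P lam * ?R lam j k)) = D"
  proof -
    have "(\<Sum>k\<in>{1..N}. \<Sum>j\<in>{1..k}. (\<Sum>e\<in>{k..N}. if valid_run N lam j k e then P (run_lowered lam j k e) * ?R (run_lowered lam j k e) j k else 0) +
       (- 1) * (P lam * ?R lam j k)) =
      (\<Sum>k\<in>{1..N}. \<Sum>j\<in>{1..k}. \<Sum>e\<in>{k..N}. if valid_run N lam j k e then P (run_lowered lam j k e) * ?R (run_lowered lam j k e) j k else 0) +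
       (- 1) * (P lam * (\<Sum>k\<in>{1..N}. \<Sum>j\<in>{1..k}. ?R lam j k))"
      by (simp only: sum.distrib sum_distrib_left)
    also have "\<dots> = P lam * B + weight N a lam * S * E t + (- 1) * (P lam * (A + B))"
      unfolding P_def B_def S_def E_def A_def sum_all_rates[OF lam]
      by (subst sum_inflow[OF lam]) (erule a | rule refl)+
    also have "\<dots> = D" by (simp add: D_def algebra_simps)
    finally show ?thesis .
  qed
  ultimately have sum: "((\<lambda>mu. P mu * complex_of_real (gen q N a mu lam)) has_sum D) (gt N)"
    by simp
  have "((\<lambda>s. Q_fn q N M alpha s (lam N)) has_vector_derivative S) (at t)"
    unfolding S_def by (rule Q_fn_derivative) (use gt_sig[OF lam] alpha in auto)
  then have "((\<lambda>s. weight N a lam * (Q_fn q N M alpha s (lam N) * E s)) has_vector_derivative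
      weight N a lam * (Q_fn q N M alpha t (lam N) * (- A * E t) + S * E t)) (at t)"
    unfolding E_def A_def
    by (intro has_vector_derivative_mult_right has_vector_derivative_mult inverse_Pi_fn_derivative)
  moreover have "weight N a lam * (Q_fn q N M alpha t (lam N) * (- A * E t) + S * E t) = D"
    unfolding D_def P_def Pt_eq E_def by (simp add: algebra_simps)
  ultimately have "((\<lambda>s. Pt q N M a alpha s lam) has_vector_derivative D) (at t)"
    unfolding Pt_eq E_def by (simp add: mult.assoc)
  with sum show ?thesis unfolding P_def by blast
qed

end

theorem mainTheorem7:
  fixes q :: real and N M :: nat and a alpha :: "nat \<Rightarrow> real" and t :: real
    and lam :: "nat \<Rightarrow> nat \<Rightarrow> int"
  assumes "0 < q" and "q < 1"
    and "\<forall>j\<in>{1..N}. 0 < a j \<and> a j \<le> 1"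
    and "\<forall>i\<in>{1..M}. 0 \<le> alpha i \<and> (\<forall>j\<in>{1..N}. alpha i < a j)"
    and "lam \<in> gt N" and "0 < t"
  shows "(\<exists>D. ((\<lambda>mu. Pt q N M a alpha t mu * complex_of_real (gen q N a mu lam)) has_sum D) (gt N)
             \<and> ((\<lambda>s. Pt q N M a alpha s lam) has_vector_derivative D) (at t))
         \<and> (\<forall>mu\<in>gt N. \<forall>nu\<in>gt N. mu \<noteq> nu \<longrightarrow> 0 \<le> gen q N a mu nu)
         \<and> (\<forall>mu\<in>gt N. ((\<lambda>nu. gen q N a mu nu) has_sum 0) (gt N))"
proof (intro conjI ballI impI)
  interpret q_param q by unfold_locales fact+
  show "\<exists>D. ((\<lambda>mu. Pt q N M a alpha t mu * complex_of_real (gen q N a mu lam)) has_sum D) (gt N)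
             \<and> ((\<lambda>s. Pt q N M a alpha s lam) has_vector_derivative D) (at t)"
  proof (rule forward_equation[OF assms(5)])
    show "a n \<noteq> 0" if "n \<in> {1..N}" for n using assms(3) that by force
    \<comment> \<open>For N > 0 the index 1 is available, and alpha_i < a_1 <= 1.\<close>
    show "\<bar>alpha i\<bar> < 1" if "i \<in> {1..M}" "N > 0" for i
    proof -
      have "1 \<in> {1..N}" using that by simp
      then have "0 \<le> alpha i" "alpha i < a 1" "a 1 \<le> 1" using assms(3,4) that by blast+
      then show ?thesis by simp
    qed
  qed
  show "0 \<le> gen q N a mu nu" if "mu \<in> gt N" "nu \<in> gt N" "mu \<noteq> nu" for mu nu
    using assms(1-3) that by (intro gen_nonneg) (auto intro: less_imp_le)
  show "((\<lambda>nu. gen q N a mu nu) has_sum 0) (gt N)" if "mu \<in> gt N" for mu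
    using that by (rule gen_row_sum)
qed

end
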